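(* Let $R:\widehat{\mathbb{C}}\to\widehat{\mathbb{C}}$ be a rational map of degree $n\ge 2$ all of whose critical points are fixed points of $R$, and let $m$ be the number of critical points of $R$ (not counting multiplicity). Then $R$ has exactly $n+1$ distinct fixed points, of which $n+1-m$ are non-critical. Moreover, the multiplier of $R$ at any non-critical fixed point does not lie in the closed disc in $\mathbb{C}$ whose diameter is the interval $\left[1,\,1+\frac{2}{n+m-2}\right]$, except in the case where $m=n$ and the multiplier of the remaining (unique non-critical) fixed point is $\frac{n}{n-1}$, which is on the boundary of this disc.
   Context: $\widehat{\mathbb{C}}=\mathbb{C}\cup\{\infty\}$ is the Riemann sphere. A critical point of a rational map $R$ is a point of $\widehat{\mathbb{C}}$ at which the derivative of $R$, computed in local coordinates, vanishes (equivalently, $R$ is not locally injective there). The multiplier of $R$ at a fixed point $z_0\in\widehat{\mathbb{C}}$ is the derivative of $R$ at $z_0$ with respect to any local coordinate at $z_0$ (the same coordinate being used in source and target). A fixed point is non-critical if it is not a critical point of $R$, i.e. its multiplier is nonzero. *)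

theory Defs
  imports
    "HOL-Complex_Analysis.Complex_Analysis"
    "HOL-Computational_Algebra.Computational_Algebra"
begin

datatype riemann_sphere = Fin complex | Infty

text \<open>
  The map of the sphere induced by the quotient \<open>p / q\<close> of two coprime polynomials.
  With \<open>d\<close> the larger degree, the value at infinity is the quotient of the coefficients
  of index \<open>d\<close>, that is, the limit of \<open>p z / q z\<close> as \<open>z\<close> tends to infinity.
\<close>

fun rational_fun :: "complex poly \<Rightarrow> complex poly \<Rightarrow> riemann_sphere \<Rightarrow> riemann_sphere" where
  "rational_fun p q (Fin z) =
     (if poly q z = 0 then Infty else Fin (poly p z / poly q z))"
| "rational_fun p q Infty =
     (let d = max (degree p) (degree q)
      in if coeff q d = 0 then Infty else Fin (coeff p d / coeff q d))"

definition rational_map :: "nat \<Rightarrow> (riemann_sphere \<Rightarrow> riemann_sphere) \<Rightarrow> bool" where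
  "rational_map n R \<longleftrightarrow>
     (\<exists>p q. coprime p q \<and> max (degree p) (degree q) = n \<and> R = rational_fun p q)"

text \<open>
  Local coordinates on the sphere: \<open>z\<close> near a finite point and \<open>1 / z\<close> near infinity.
  \<open>coord a\<close> is the coordinate used at the point \<open>a\<close> and \<open>coord_inv a\<close> is its inverse.
  The values \<open>coord (Fin a) Infty\<close> and \<open>coord Infty (Fin 0)\<close> are dummies; the points in
  question lie outside the domains of these coordinates, so the values do not affect
  derivatives at \<open>a\<close>.
\<close>

fun coord :: "riemann_sphere \<Rightarrow> riemann_sphere \<Rightarrow> complex" where
  "coord (Fin a) (Fin z) = z"
| "coord (Fin a) Infty = 0"
| "coord Infty (Fin z) = 1 / z"
| "coord Infty Infty = 0"

fun coord_inv :: "riemann_sphere \<Rightarrow> complex \<Rightarrow> riemann_sphere" where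
  "coord_inv (Fin a) w = Fin w"
| "coord_inv Infty w = (if w = 0 then Infty else Fin (1 / w))"

definition local_deriv :: "(riemann_sphere \<Rightarrow> riemann_sphere) \<Rightarrow> riemann_sphere \<Rightarrow> complex" where
  "local_deriv R a = deriv (\<lambda>w. coord (R a) (R (coord_inv a w))) (coord a a)"

definition critical_point :: "(riemann_sphere \<Rightarrow> riemann_sphere) \<Rightarrow> riemann_sphere \<Rightarrow> bool" where
  "critical_point R a \<longleftrightarrow> local_deriv R a = 0"

definition fixed_point :: "(riemann_sphere \<Rightarrow> riemann_sphere) \<Rightarrow> riemann_sphere \<Rightarrow> bool" where
  "fixed_point R a \<longleftrightarrow> R a = a"

text \<open>
  Meaningful only when \<open>fixed_point R a\<close>: then \<open>local_deriv R a\<close> uses the same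
  coordinate \<open>coord a\<close> in source and target, and by the chain rule any other local
  coordinate at \<open>a\<close> would give the same value.
\<close>

definition multiplier :: "(riemann_sphere \<Rightarrow> riemann_sphere) \<Rightarrow> riemann_sphere \<Rightarrow> complex" where
  "multiplier R a = local_deriv R a"

definition disc_with_diameter :: "complex \<Rightarrow> complex \<Rightarrow> complex set" where
  "disc_with_diameter a b = cball (midpoint a b) (dist a b / 2)"

end

theory Submission
  imports Defs
begin

text \<open>
  Two facts carry the theorem. The first is the fixed point formula: the sum of \<open>1 / (1 - \<mu>)\<close> over
  the \<open>n + 1\<close> fixed points, with multipliers \<open>\<mu>\<close>, equals \<open>1\<close>. The second is dynamical: if all
  critical points are fixed, every other fixed point is repelling, that is, \<open>norm \<mu> > 1\<close>. In
  particular no multiplier is \<open>1\<close>, so the fixed points are simple and there are \<open>n + 1\<close> of them.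

  The statement about the disc follows by taking real parts. Each of the \<open>m\<close> critical points contributes
  \<open>1\<close> to the sum. A repelling point contributes a term with real part less than \<open>1 / 2\<close>. Hence for one
  noncritical fixed point, with \<open>n - m\<close> others, the real part of its term is at least
  \<open>1 - m - (n - m) / 2 = - (n + m - 2) / 2\<close>, with equality only if there are no others. The map
  \<open>\<mu> \<mapsto> 1 / (1 - \<mu>)\<close> takes the disc in question, without the point \<open>1\<close>, to the half plane of real parts
  at most that number. If there are no others, then \<open>m = n\<close> and the formula yields \<open>n / (n - 1)\<close>.

  The dynamical fact is \<open>norm_deriv_gt_1_at_fixed_point\<close>. Outside the critical points and their preimages
  the map is a covering of the complement of the critical points (\<open>covering_space_rational\<close>). So all
  iterates have inverse branches on a disc around a noncritical fixed point that reaches up to a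
  critical point. By the theorems of Schottky and Montel these branches form a normal family. If the fixed
  point were not repelling, some of the branches would converge to the identity, which is impossible
  near the superattracting critical point on the boundary of the disc. Besides infinity, this
  argument needs two critical points as omitted values; a map with just one more critical point
  is a monomial up to conjugation and is treated directly.

  Both facts are proved for maps with a critical point at infinity (\<open>normal_form_fixed_points\<close>). A
  critical point always exists, and conjugation by a Moebius transformation moves it to infinity
  (\<open>conjugate_fixed_point_to_Infty\<close>).
\<close>

section \<open>Covering maps and families omitting two values\<close>

text \<open>
  Around a point \<open>z\<close> of the base, local inverses at the \<open>n\<close> preimages of \<open>z\<close> give \<open>n\<close> disjoint
  sheets over one neighbourhood of \<open>z\<close>. Counting preimages shows that nothing else lies above
  that neighbourhood. This replaces the usual properness argument, which would need the map on
  the compact sphere.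
\<close>

lemma covering_space_if_constant_fibre_card:
  fixes f :: "complex \<Rightarrow> complex"
  assumes "open T" and hol: "f holomorphic_on T" and img: "f ` T \<subseteq> S"
    and regular: "\<And>w. w \<in> T \<Longrightarrow> deriv f w \<noteq> 0"
    and fibre: "\<And>z. z \<in> S \<Longrightarrow> card {w \<in> T. f w = z} = n" and "n > 0"
  shows "covering_space T f S"
proof
  show "continuous_on T f" using hol holomorphic_on_imp_continuous_on by blast
  have ne: "{w \<in> T. f w = z} \<noteq> {}" if "z \<in> S" for z
    using fibre[OF that] \<open>n > 0\<close> by (metis card.empty less_numeral_extra(3))
  have fin: "finite {w \<in> T. f w = z}" if "z \<in> S" for z
    using fibre[OF that] \<open>n > 0\<close> by (metis card.infinite less_numeral_extra(3))
  show "f ` T = S" using img ne by fastforce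
  fix z assume "z \<in> S"
  define A where "A = {w \<in> T. f w = z}"
  have A: "finite A" "A \<noteq> {}" "card A = n" "A \<subseteq> T"
    using ne fin fibre \<open>z \<in> S\<close> by (auto simp: A_def)
  have "\<exists>r>0. ball w r \<subseteq> T \<and> inj_on f (ball w r)" if "w \<in> A" for w
    by (metis A(4) \<open>open T\<close> has_complex_derivative_locally_injective hol regular subsetD that)
  then obtain r where r: "\<And>w. w \<in> A \<Longrightarrow> r w > 0 \<and> ball w (r w) \<subseteq> T \<and> inj_on f (ball w (r w))"
    by metis
  obtain d where d: "\<And>w. d w > 0" "\<And>w w'. w' \<in> A \<Longrightarrow> w' \<noteq> w \<Longrightarrow> d w \<le> dist w w'"
    using finite_set_avoid[OF A(1)] by metis
  define B where "B w = ball w (min (r w) (d w / 2))" for w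
  have B: "open (B w)" "w \<in> B w" "B w \<subseteq> T" "inj_on f (B w)" if "w \<in> A" for w
    using r[OF that] d(1)[of w] by (auto simp: B_def inj_on_def)
  have disj: "B w \<inter> B w' = {}" if "w \<in> A" "w' \<in> A" "w \<noteq> w'" for w w'
  proof -
    have False if "x \<in> B w" "x \<in> B w'" for x
    proof -
      have "dist w x < d w / 2" "dist w' x < d w' / 2" using that by (auto simp: B_def)
      then have "dist w w' < (d w + d w') / 2" using dist_triangle2[of w w' x] by argo
      moreover have "d w \<le> dist w w'" "d w' \<le> dist w w'"
        using d(2)[OF \<open>w' \<in> A\<close>, of w] d(2)[OF \<open>w \<in> A\<close>, of w'] \<open>w \<noteq> w'\<close> by (auto simp: dist_commute)
      ultimately show False by argo
    qed
    then show ?thesis by blast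
  qed
  define V where "V = (\<Inter>w\<in>A. f ` B w)"
  have opfB: "open (f ` B w)" if "w \<in> A" for w
    using B[OF that] open_mapping_thm3 hol holomorphic_on_subset by metis
  have "open V" unfolding V_def using A(1) opfB by (intro open_INT) auto
  have "z \<in> V" unfolding V_def using B(2) by (force simp: A_def)
  have "V \<subseteq> S"
  proof -
    obtain w where "w \<in> A" using A(2) by blast
    then show ?thesis using B(3)[of w] img by (force simp: V_def)
  qed
  define U where "U w = B w \<inter> f -` V" for w
  have U: "open (U w)" "f ` U w = V" "U w \<subseteq> T" "inj_on f (U w)" if "w \<in> A" for w
  proof -
    have "continuous_on (B w) f"
      using B(3)[OF that] hol by (meson holomorphic_on_imp_continuous_on holomorphic_on_subset)
    then show "open (U w)" unfolding U_def
      by (metis B(1) Int_commute \<open>open V\<close> continuous_open_preimage inf_commute that)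
    show "f ` U w = V" using that unfolding U_def V_def by blast
    show "U w \<subseteq> T" "inj_on f (U w)" using B[OF that] by (auto simp: U_def inj_on_def)
  qed
  \<comment> \<open>A point of \<open>V\<close> has one preimage in each of the \<open>n\<close> disjoint sheets, so it has no others.\<close>
  have cover: "\<Union>(U ` A) = T \<inter> f -` V"
  proof
    show "\<Union>(U ` A) \<subseteq> T \<inter> f -` V" using B(3) by (auto simp: U_def)
    show "T \<inter> f -` V \<subseteq> \<Union>(U ` A)"
    proof
      fix x assume x: "x \<in> T \<inter> f -` V"
      have "\<exists>y. y \<in> B w \<and> f y = f x" if "w \<in> A" for w using x that by (force simp: V_def)
      then obtain s where s: "\<And>w. w \<in> A \<Longrightarrow> s w \<in> B w \<and> f (s w) = f x" by metis
      have "inj_on s A" using s disj by (force simp: inj_on_def)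
      then have "card (s ` A) = n" using A(3) by (simp add: card_image)
      moreover have "s ` A \<subseteq> {w \<in> T. f w = f x}" using s B(3) by blast
      moreover have fx: "f x \<in> S" using x \<open>V \<subseteq> S\<close> by blast
      ultimately have "s ` A = {w \<in> T. f w = f x}"
        by (metis card_subset_eq fibre fin)
      then have "x \<in> s ` A" using x by blast
      then show "x \<in> \<Union>(U ` A)" using s x by (auto simp: U_def)
    qed
  qed
  have sheets: "\<exists>g. homeomorphism (U w) V f g" if w: "w \<in> A" for w
  proof -
    have hU: "f holomorphic_on U w" using U(3)[OF w] hol holomorphic_on_subset by blast
    obtain g where g: "g holomorphic_on (f ` U w)" "\<And>z. z \<in> U w \<Longrightarrow> g (f z) = z"
      using holomorphic_has_inverse[OF hU U(1)[OF w] U(4)[OF w]] by metis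
    have "homeomorphism (U w) V f g"
      using U(2)[OF w] g hU by (intro homeomorphismI) (auto intro: holomorphic_on_imp_continuous_on)
    then show ?thesis by blast
  qed
  have "pairwise disjnt (U ` A)"
    using disj by (auto simp: pairwise_def disjnt_def U_def)
  moreover have "openin (top_of_set S) V"
    using \<open>open V\<close> \<open>V \<subseteq> S\<close> by (simp add: open_subset)
  moreover have "openin (top_of_set T) (U w)" if "w \<in> A" for w
    using U[OF that] by (simp add: open_subset)
  ultimately show "\<exists>V. z \<in> V \<and> openin (top_of_set S) V \<and>
      (\<exists>v. \<Union>v = T \<inter> f -` V \<and> (\<forall>u\<in>v. openin (top_of_set T) u) \<and>
        pairwise disjnt v \<and> (\<forall>u\<in>v. \<exists>q. homeomorphism u V f q))"
    using \<open>z \<in> V\<close> cover sheets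
    by (intro exI[of _ V] conjI exI[of _ "U ` A"]) auto
qed

text \<open>
  Schottky's theorem after an affine change of variables in source and target. The bound depends
  only on the two omitted values, the radii and the value at the centre, so it is uniform over
  the whole family.
\<close>

lemma Schottky_locally_bounded:
  fixes a b z0 w0 :: complex
  assumes "a \<noteq> b" and K: "compact K" "K \<subseteq> ball z0 \<rho>"
  shows "\<exists>M. \<forall>h. h holomorphic_on ball z0 \<rho> \<and> h z0 = w0 \<and> (\<forall>z\<in>ball z0 \<rho>. h z \<noteq> a \<and> h z \<noteq> b)
           \<longrightarrow> (\<forall>z\<in>K. norm (h z) \<le> M)"
proof (cases "K = {}")
  case False
  obtain s where s: "0 < s" "s < \<rho>" "K \<subseteq> cball z0 s"
  proof -
    have "continuous_on K (dist z0)" by (intro continuous_intros)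
    then obtain x where x: "x \<in> K" "\<And>y. y \<in> K \<Longrightarrow> dist z0 y \<le> dist z0 x"
      using continuous_attains_sup[OF K(1) False] by meson
    have "dist z0 x < \<rho>" using x K by auto
    then have "0 < (dist z0 x + \<rho>) / 2" "(dist z0 x + \<rho>) / 2 < \<rho>" "dist z0 x \<le> (dist z0 x + \<rho>) / 2"
      using zero_le_dist[of z0 x] by argo+
    then show thesis using x(2) that[of "(dist z0 x + \<rho>) / 2"] by force
  qed
  define s' where "s' = (s + \<rho>) / 2"
  have s': "s < s'" "s' < \<rho>" "0 < s'" using s by (auto simp: s'_def)
  define t where "t = s / s'"
  have t: "0 < t" "t < 1" using s s' by (auto simp: t_def)
  define r where "r = norm ((w0 - a) / (b - a))"
  define E where "E = exp (pi * exp (pi * (2 + 2 * r + 12 * t / (1 - t))))"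
  have "norm (h z) \<le> norm a + norm (b - a) * E"
    if h: "h holomorphic_on ball z0 \<rho>" "h z0 = w0" "\<forall>z\<in>ball z0 \<rho>. h z \<noteq> a \<and> h z \<noteq> b"
      and z: "z \<in> K" for h z
  proof -
    define \<phi> where "\<phi> \<zeta> = z0 + of_real s' * \<zeta>" for \<zeta> :: complex
    define \<zeta> where "\<zeta> = (z - z0) / of_real s'"
    have \<phi>: "\<phi> \<zeta> \<in> ball z0 \<rho>" if "\<zeta> \<in> cball 0 1" for \<zeta>
    proof -
      have "norm (of_real s' * \<zeta>) \<le> s'" using that s' by (simp add: norm_mult)
      then show ?thesis using s' by (simp add: \<phi>_def dist_norm)
    qed
    have \<zeta>: "\<phi> \<zeta> = z" "norm \<zeta> \<le> t"
    proof -
      show "\<phi> \<zeta> = z" using s' by (simp add: \<phi>_def \<zeta>_def)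
      have "norm (z - z0) \<le> s" using z s(3) by (auto simp: dist_norm norm_minus_commute)
      then show "norm \<zeta> \<le> t" using s' by (simp add: \<zeta>_def t_def norm_divide divide_right_mono)
    qed
    have "norm ((h (\<phi> \<zeta>) - a) / (b - a)) \<le> E" unfolding E_def
    proof (rule Schottky[where f = "\<lambda>\<zeta>. (h (\<phi> \<zeta>) - a) / (b - a)"])
      have "(h \<circ> \<phi>) holomorphic_on cball 0 1"
      proof (rule holomorphic_on_compose_gen[OF _ h(1)])
        show "\<phi> holomorphic_on cball 0 1" unfolding \<phi>_def by (intro holomorphic_intros)
      qed (use \<phi> in blast)
      then show "(\<lambda>\<zeta>. (h (\<phi> \<zeta>) - a) / (b - a)) holomorphic_on cball 0 1"
        using \<open>a \<noteq> b\<close> by (intro holomorphic_intros) (auto simp: o_def)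
      show "norm ((h (\<phi> 0) - a) / (b - a)) \<le> r" by (simp add: r_def \<phi>_def h(2))
      show "\<not> ((h (\<phi> z) - a) / (b - a) = 0 \<or> (h (\<phi> z) - a) / (b - a) = 1)"
        if "z \<in> cball 0 1" for z using h(3) \<phi>[OF that] \<open>a \<noteq> b\<close> by auto
    qed (use t \<zeta> in auto)
    then have "norm (h z - a) \<le> norm (b - a) * E"
      using \<open>a \<noteq> b\<close> \<zeta>(1) by (simp add: norm_divide field_simps)
    then show ?thesis using norm_triangle_sub[of "h z" a] by linarith
  qed
  then show ?thesis by blast
qed auto

section \<open>Inverse branches and repelling fixed points\<close>

text \<open>
  The branches \<open>g k\<close> of the inverses of \<open>f ^^ k\<close> that fix \<open>z0\<close>. The condition \<open>T \<subseteq> S\<close> is what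
  makes the construction repeatable: each branch takes values in \<open>S\<close> and so can be lifted
  through the covering once more.
\<close>

lemma inverse_branches_exist:
  fixes f :: "complex \<Rightarrow> complex"
  assumes cov: "covering_space T f S" and "open T" "T \<subseteq> S" and hol: "f holomorphic_on T"
    and z0: "z0 \<in> T" "f z0 = z0" and D: "z0 \<in> D" "D \<subseteq> S" "open D" "convex D"
  obtains g where "\<And>k. g k holomorphic_on D" "\<And>k. g k ` D \<subseteq> S" "\<And>k. g (Suc k) ` D \<subseteq> T"
    "\<And>k. g k z0 = z0" "\<And>x. x \<in> D \<Longrightarrow> g 0 x = x" "\<And>k x. x \<in> D \<Longrightarrow> f (g (Suc k) x) = g k x"
proof -
  define P where "P k h \<longleftrightarrow> h holomorphic_on D \<and> h ` D \<subseteq> S \<and> h z0 = z0 \<and> (k = 0 \<longrightarrow> (\<forall>x. h x = x))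
     \<and> (k > 0 \<longrightarrow> h ` D \<subseteq> T)"
    for k :: nat and h :: "complex \<Rightarrow> complex"
  define Q where "Q k h h' \<longleftrightarrow> (\<forall>x\<in>D. f (h' x) = h x)" for k :: nat and h h' :: "complex \<Rightarrow> complex"
  have "\<exists>g. \<forall>k. P k (g k) \<and> Q k (g k) (g (Suc k))"
  proof (rule dependent_nat_choice[of P Q])
    show "\<exists>h. P 0 h" using D by (intro exI[of _ "\<lambda>x. x"]) (auto simp: P_def intro: holomorphic_intros)
    fix h k assume h: "P k h"
    then have holh: "h holomorphic_on D" and him: "h \<in> D \<rightarrow> S" by (auto simp: P_def)
    have "simply_connected D" "locally path_connected D"
      using D(4) convex_imp_simply_connected convex_imp_locally_path_connected by blast+
    moreover have "continuous_on D h" using holh holomorphic_on_imp_continuous_on by blast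
    moreover have "h z0 = f z0" using h z0(2) by (simp add: P_def)
    ultimately obtain h' where h': "continuous_on D h'" "h' \<in> D \<rightarrow> T" "h' z0 = z0"
      "\<And>x. x \<in> D \<Longrightarrow> f (h' x) = h x"
      using covering_space_lift_strong[OF cov z0(1) D(1) _ _ _ him] by metis
    have "h' holomorphic_on D"
      using covering_space_lift_is_holomorphic[OF cov \<open>open T\<close> hol holh him h'(2,1,4)] .
    then have "P (Suc k) h' \<and> Q k h h'"
      using h' \<open>T \<subseteq> S\<close> by (auto simp: P_def Q_def)
    then show "\<exists>h'. P (Suc k) h' \<and> Q k h h'" by blast
  qed
  then obtain g where "\<And>k. P k (g k)" "\<And>k. Q k (g k) (g (Suc k))" by blast
  then show thesis using that[of g] by (auto simp: P_def Q_def)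
qed

text \<open>
  The semigroup law of the inverse branches. Both sides are lifts of the same map and agree
  at \<open>z0\<close>, so uniqueness of lifts applies wherever the composition is defined.
\<close>

lemma inverse_branches_compose:
  fixes f :: "complex \<Rightarrow> complex"
  assumes cov: "covering_space T f S"
    and g: "\<And>k. continuous_on D (g k)" "\<And>k. g k ` D \<subseteq> S" "\<And>k. g (Suc k) ` D \<subseteq> T"
    "\<And>k. g k z0 = z0" "\<And>x. x \<in> D \<Longrightarrow> g 0 x = x" "\<And>k x. x \<in> D \<Longrightarrow> f (g (Suc k) x) = g k x"
    and D': "connected D'" "z0 \<in> D'" "D' \<subseteq> D" "g k ` D' \<subseteq> D" and "x \<in> D'"
  shows "g l (g k x) = g (k + l) x"
  using \<open>x \<in> D'\<close>
proof (induction l arbitrary: x)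
  case 0
  then show ?case using D'(4) g(5) by auto
next
  case (Suc l)
  show ?case
  proof (rule covering_space_lift_unique[OF cov, where f = "g (k + l)" and ?g1.0 = "\<lambda>x. g (Suc l) (g k x)"
        and ?g2.0 = "g (k + Suc l)" and T = D' and a = z0])
    show "continuous_on D' (g (k + l))" "continuous_on D' (g (k + Suc l))"
      using g(1) D'(3) continuous_on_subset by blast+
    show "continuous_on D' (\<lambda>x. g (Suc l) (g k x))"
      using g(1) D'(3,4) by (intro continuous_on_compose2[OF g(1)]) (auto intro: continuous_on_subset)
    show "g (k + l) \<in> D' \<rightarrow> S" "(\<lambda>x. g (Suc l) (g k x)) \<in> D' \<rightarrow> T" "g (k + Suc l) \<in> D' \<rightarrow> T"
      using g(2)[of "k + l"] g(3)[of l] g(3)[of "k + l"] D'(3,4) by (auto simp: image_subset_iff)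
    show "g (k + l) x = f (g (Suc l) (g k x))" if "x \<in> D'" for x
      using that Suc.IH[OF that] g(6)[of "g k x" l] D'(4) by auto
    show "g (k + l) x = f (g (k + Suc l) x)" if "x \<in> D'" for x
      using that D'(3) g(6)[of x "k + l"] by auto
  qed (use g(4) D' Suc.prems in auto)
qed

text \<open>
  On the largest disc \<open>D\<close> around \<open>z0\<close> that avoids \<open>C\<close>, all the
  inverse branches \<open>g k\<close> fixing \<open>z0\<close> exist. They omit two values, so they form a normal family.
  If the multiplier of \<open>f\<close> at \<open>z0\<close> had modulus at most \<open>1\<close>, the derivatives of the branches at
  \<open>z0\<close> would be bounded away from \<open>0\<close>, so a limit \<open>G\<close> of branches \<open>g (r j)\<close> would be nonconstant.
  For a limit \<open>H\<close> of the quotient branches \<open>g (r (j + 1) - r j)\<close> the semigroup law gives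
  \<open>H \<circ> G = G\<close>, hence \<open>H\<close> is the identity on an open set and therefore on \<open>D\<close>. But a point of
  \<open>C\<close> lies on the boundary of \<open>D\<close> and attracts its neighbourhood, which is incompatible with
  inverse branches that are close to the identity near it.
\<close>

lemma norm_deriv_gt_1_at_fixed_point:
  fixes f :: "complex \<Rightarrow> complex" and C :: "complex set"
  assumes cov: "covering_space T f (- C)" and "open T" "T \<subseteq> - C" and hol: "f holomorphic_on T"
    and C: "finite C" "a \<in> C" "b \<in> C" "a \<noteq> b"
    and attr: "\<And>c. c \<in> C \<Longrightarrow> \<exists>\<delta>>0. \<forall>u. dist u c \<le> \<delta> \<longrightarrow> dist (f u) c \<le> dist u c / 2"
    and z0: "z0 \<in> T" "f z0 = z0"
  shows "norm (deriv f z0) > 1"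
proof (rule ccontr)
  assume not_repelling: "\<not> ?thesis"
  obtain c where c: "c \<in> C" "\<And>c'. c' \<in> C \<Longrightarrow> dist z0 c \<le> dist z0 c'"
    using C ex_is_arg_min_if_finite[OF C(1), of "dist z0"] by (auto simp: is_arg_min_linorder)
  define \<rho> where "\<rho> = dist z0 c"
  have "\<rho> > 0" using z0(1) c(1) \<open>T \<subseteq> - C\<close> by (auto simp: \<rho>_def)
  define D where "D = ball z0 \<rho>"
  have D: "z0 \<in> D" "D \<subseteq> - C" "open D" "convex D"
    using \<open>\<rho> > 0\<close> c(2) by (force simp: D_def \<rho>_def)+
  obtain g where g: "\<And>k. g k holomorphic_on D" "\<And>k. g k ` D \<subseteq> - C" "\<And>k. g (Suc k) ` D \<subseteq> T"
    "\<And>k. g k z0 = z0" "\<And>x. x \<in> D \<Longrightarrow> g 0 x = x" "\<And>k x. x \<in> D \<Longrightarrow> f (g (Suc k) x) = g k x"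
    using inverse_branches_exist[OF cov \<open>open T\<close> \<open>T \<subseteq> - C\<close> hol z0 D] by metis
  have contg: "continuous_on D (g k)" for k using g(1) holomorphic_on_imp_continuous_on by blast

  have iterate: "(f ^^ k) (g k x) = x" if "x \<in> D" for k x
  proof (induction k)
    case 0 show ?case using g(5) that by simp
  next
    case (Suc k)
    show ?case using Suc g(6)[OF that, of k] by (simp add: funpow_swap1)
  qed

  have deriv_g: "norm (deriv (g k) z0) \<ge> 1" for k
  proof (induction k)
    case 0
    have "deriv (g 0) z0 = deriv (\<lambda>x. x) z0"
      by (rule complex_derivative_transform_within_open[OF g(1) _ D(3,1)]) (auto simp: g(5))
    then show ?case by simp
  next
    case (Suc k)
    have "deriv (g k) z0 = deriv (f \<circ> g (Suc k)) z0"
    proof (rule complex_derivative_transform_within_open[OF g(1) _ D(3,1)])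
      show "f \<circ> g (Suc k) holomorphic_on D"
        using holomorphic_on_compose_gen[OF g(1) hol] g(3) by blast
    qed (simp add: g(6))
    also have "\<dots> = deriv f z0 * deriv (g (Suc k)) z0"
      using deriv_chain[of "g (Suc k)" z0 f] g(1)[of "Suc k"] hol D z0 \<open>open T\<close> g(4)
      by (simp add: holomorphic_on_imp_differentiable_at)
    finally have "norm (deriv (g k) z0) = norm (deriv f z0) * norm (deriv (g (Suc k)) z0)"
      by (simp add: norm_mult)
    also have "\<dots> \<le> 1 * norm (deriv (g (Suc k)) z0)"
      using not_repelling by (intro mult_right_mono) auto
    finally show ?case using Suc by simp
  qed

  have bounded: "\<exists>M. \<forall>h\<in>range g. \<forall>z\<in>K. norm (h z) \<le> M" if "compact K" "K \<subseteq> D" for K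
  proof -
    obtain M where M: "\<And>h z. h holomorphic_on D \<and> h z0 = z0 \<and> (\<forall>z\<in>D. h z \<noteq> a \<and> h z \<noteq> b) \<Longrightarrow>
        z \<in> K \<Longrightarrow> norm (h z) \<le> M"
      using Schottky_locally_bounded[OF \<open>a \<noteq> b\<close> \<open>compact K\<close>, of z0 \<rho> z0] \<open>K \<subseteq> D\<close>
      unfolding D_def by blast
    have "\<forall>z\<in>D. g k z \<noteq> a \<and> g k z \<noteq> b" for k using g(2)[of k] C(2,3) by auto
    then have "norm (g k z) \<le> M" if "z \<in> K" for k z using M[OF _ that, of "g k"] g(1,4) by simp
    then show ?thesis by blast
  qed
  have hol_range: "h holomorphic_on D" if "h \<in> range g" for h using g(1) that by auto
  obtain G r where G: "G holomorphic_on D" and r: "strict_mono (r :: nat \<Rightarrow> nat)"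
    and limG: "\<And>x. x \<in> D \<Longrightarrow> (\<lambda>j. g (r j) x) \<longlonglongrightarrow> G x"
    and unifG: "\<And>K. compact K \<Longrightarrow> K \<subseteq> D \<Longrightarrow> uniform_limit K (g \<circ> r) G sequentially"
    using Montel[OF D(3) hol_range bounded, where ?\<F> = g] by auto
  define l where "l j = r (Suc j) - r j" for j
  have l: "l j \<ge> 1" "r j + l j = r (Suc j)" for j
    using strict_monoD[OF r, of j "Suc j"] by (auto simp: l_def)
  obtain H s where H: "H holomorphic_on D" and s: "strict_mono (s :: nat \<Rightarrow> nat)"
    and limH: "\<And>x. x \<in> D \<Longrightarrow> (\<lambda>i. g (l (s i)) x) \<longlonglongrightarrow> H x"
    and unifH: "\<And>K. compact K \<Longrightarrow> K \<subseteq> D \<Longrightarrow> uniform_limit K ((g \<circ> l) \<circ> s) H sequentially"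
  proof -
    have "range (g \<circ> l) \<subseteq> range g" by auto
    from Montel[OF D(3) hol_range bounded this] obtain H s
      where "H holomorphic_on D" "strict_mono (s :: nat \<Rightarrow> nat)"
        "\<And>x. x \<in> D \<Longrightarrow> (\<lambda>i. (g \<circ> l) (s i) x) \<longlonglongrightarrow> H x"
        "\<And>K. compact K \<Longrightarrow> K \<subseteq> D \<Longrightarrow> uniform_limit K ((g \<circ> l) \<circ> s) H sequentially" by blast
    then show thesis using that[of H s] by simp
  qed

  have half: "cball z0 (\<rho>/2) \<subseteq> D" using \<open>\<rho> > 0\<close> by (auto simp: D_def)
  have "G z0 = z0" using LIMSEQ_unique[OF limG[OF D(1)]] g(4) by simp
  have "deriv G z0 \<noteq> 0"
  proof -
    have "uniform_limit (ball z0 (\<rho>/2)) (g \<circ> r) G sequentially"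
      using uniform_limit_on_subset[OF unifG[OF _ half]] by force
    then have "(\<lambda>j. (deriv ^^ 1) ((g \<circ> r) j) z0) \<longlonglongrightarrow> (deriv ^^ 1) G z0"
    proof (rule higher_deriv_complex_uniform_limit)
      show "\<forall>\<^sub>F j in sequentially. (g \<circ> r) j holomorphic_on ball z0 (\<rho>/2)"
      proof (intro always_eventually allI)
        fix j
        show "(g \<circ> r) j holomorphic_on ball z0 (\<rho>/2)"
          unfolding comp_apply
          by (rule holomorphic_on_subset[OF g(1) order_trans[OF ball_subset_cball half]])
      qed
    qed (use \<open>\<rho> > 0\<close> in auto)
    then have "(\<lambda>j. norm (deriv (g (r j)) z0)) \<longlonglongrightarrow> norm (deriv G z0)"
      by (intro tendsto_norm) simp
    then have "norm (deriv G z0) \<ge> 1"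
      by (rule Lim_bounded2) (use deriv_g in auto)
    then show ?thesis by auto
  qed
  then have "\<not> G constant_on D"
    using D(1,3) by (metis complex_derivative_transform_within_open constant_on_def deriv_const
        holomorphic_on_const G)

  \<comment> \<open>Passing to the limit in the composition rule shows that \<open>H\<close> fixes an open set of values of \<open>G\<close>.\<close>
  obtain \<epsilon> where \<epsilon>: "\<epsilon> > 0" "cball z0 \<epsilon> \<subseteq> D" "G ` cball z0 \<epsilon> \<subseteq> ball z0 (\<rho>/4)"
  proof -
    have "continuous_on D G" using G holomorphic_on_imp_continuous_on by blast
    then have "open (D \<inter> G -` ball z0 (\<rho>/4))"
      using D(3) continuous_open_preimage by blast
    moreover have "z0 \<in> D \<inter> G -` ball z0 (\<rho>/4)" using D(1) \<open>G z0 = z0\<close> \<open>\<rho> > 0\<close> by simp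
    ultimately show thesis using open_contains_cball that by (metis Int_subset_iff image_subset_iff_subset_vimage)
  qed
  have G\<epsilon>: "dist z0 (G x) < \<rho>/4" if "x \<in> cball z0 \<epsilon>" for x
    using \<epsilon>(3) that by (metis image_subset_iff mem_ball)
  have "eventually (\<lambda>j. \<forall>x\<in>cball z0 \<epsilon>. dist ((g \<circ> r) j x) (G x) < \<rho>/4) sequentially"
    using unifG[OF compact_cball \<epsilon>(2)] \<open>\<rho> > 0\<close> by (rule uniform_limitD[OF _ divide_pos_pos]) simp
  then have small: "eventually (\<lambda>j. g (r j) ` cball z0 \<epsilon> \<subseteq> cball z0 (\<rho>/2)) sequentially"
  proof eventually_elim
    case (elim j)
    show ?case
    proof clarify
      fix x assume x: "x \<in> cball z0 \<epsilon>"
      have "dist z0 (G x) < \<rho>/4" using G\<epsilon>[OF x] .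
      moreover have "dist (g (r j) x) (G x) < \<rho>/4" using elim x by auto
      ultimately show "g (r j) x \<in> cball z0 (\<rho>/2)"
        using dist_triangle2[of z0 "g (r j) x" "G x"] unfolding mem_cball by argo
    qed
  qed
  have HG: "H (G x) = G x" if x: "x \<in> ball z0 \<epsilon>" for x
  proof -
    have x': "x \<in> cball z0 \<epsilon>" "x \<in> D" using x \<epsilon>(2) by auto
    define y where "y i = g (r (s i)) x" for i
    have Gx: "G x \<in> cball z0 (\<rho>/2)" using G\<epsilon>[OF x'(1)] \<open>\<rho> > 0\<close> by simp
    have ylim: "y \<longlonglongrightarrow> G x"
      unfolding y_def using LIMSEQ_subseq_LIMSEQ[OF limG[OF x'(2)] s] by (simp add: o_def)
    have ev: "eventually (\<lambda>i. g (r (s i)) ` cball z0 \<epsilon> \<subseteq> cball z0 (\<rho>/2)) sequentially"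
      using eventually_subseq[OF s small] .
    have evy: "eventually (\<lambda>i. y i \<in> cball z0 (\<rho>/2)) sequentially"
      unfolding y_def using ev by eventually_elim (use x'(1) in blast)
    have "eventually (\<lambda>i. g (l (s i)) (y i) = g (r (Suc (s i))) x) sequentially"
      using ev
    proof eventually_elim
      case (elim i)
      show ?case unfolding y_def l(2)[symmetric]
        using inverse_branches_compose[OF cov contg g(2-6), of "cball z0 \<epsilon>" "r (s i)" x "l (s i)"] \<epsilon> elim half x'
        by auto
    qed
    moreover have "(\<lambda>i. g (r (Suc (s i))) x) \<longlonglongrightarrow> G x"
      using LIMSEQ_subseq_LIMSEQ[OF limG[OF x'(2)], of "Suc \<circ> s"] s by (simp add: o_def strict_mono_def)
    ultimately have lim1: "(\<lambda>i. g (l (s i)) (y i)) \<longlonglongrightarrow> G x"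
      using tendsto_cong by fast
    have "(\<lambda>i. g (l (s i)) (y i)) \<longlonglongrightarrow> H (G x)"
    proof -
      have "isCont H (G x)"
        using H D(3) Gx half by (meson holomorphic_on_imp_continuous_on continuous_on_eq_continuous_at subsetD)
      then have Hy: "(\<lambda>i. H (y i)) \<longlonglongrightarrow> H (G x)" using ylim by (rule isCont_tendsto_compose)
      have "(\<lambda>i. g (l (s i)) (y i) - H (y i)) \<longlonglongrightarrow> 0"
      proof (rule tendstoI)
        fix e :: real assume "e > 0"
        have "eventually (\<lambda>i. \<forall>u\<in>cball z0 (\<rho>/2). dist (((g \<circ> l) \<circ> s) i u) (H u) < e) sequentially"
          using unifH[OF compact_cball half] \<open>e > 0\<close> by (rule uniform_limitD)
        then show "eventually (\<lambda>i. dist (g (l (s i)) (y i) - H (y i)) 0 < e) sequentially"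
          using evy by eventually_elim (auto simp: dist_norm)
      qed
      from tendsto_add[OF this Hy] show ?thesis by simp
    qed
    then show ?thesis using lim1 LIMSEQ_unique by blast
  qed
  have H_id: "H x = x" if "x \<in> D" for x
  proof (rule analytic_continuation_open[where f = H and g = "\<lambda>x. x" and s = "G ` ball z0 \<epsilon>" and s' = D])
    show "open (G ` ball z0 \<epsilon>)"
      using \<epsilon> D(3,4) G \<open>\<not> G constant_on D\<close>
      by (intro open_mapping_thm[of G D]) (auto intro: convex_connected)
    show "G ` ball z0 \<epsilon> \<subseteq> D"
    proof clarify
      fix x assume "x \<in> ball z0 \<epsilon>"
      then show "G x \<in> D" using G\<epsilon>[of x] \<open>\<rho> > 0\<close> by (simp add: D_def)
    qed
    show "\<And>z. z \<in> G ` ball z0 \<epsilon> \<Longrightarrow> H z = z" using HG by auto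
  qed (use that D H \<epsilon>(1) in \<open>auto intro: convex_connected\<close>)

  \<comment> \<open>Near the attracting point \<open>c\<close> on the boundary of \<open>D\<close>, inverse branches close to the identity
      contradict the contraction towards \<open>c\<close>.\<close>
  obtain \<delta> where \<delta>: "\<delta> > 0" "\<And>u. dist u c \<le> \<delta> \<Longrightarrow> dist (f u) c \<le> dist u c / 2"
    using attr[OF c(1)] by blast
  have contract: "dist ((f ^^ Suc k) u) c \<le> dist u c / 2" if u: "dist u c \<le> \<delta>" for k u
  proof (induction k)
    case 0 show ?case using \<delta>(2)[OF u] by simp
  next
    case (Suc k)
    have "dist ((f ^^ Suc k) u) c \<le> \<delta>" using Suc u zero_le_dist[of u c] by linarith
    from \<delta>(2)[OF this] have "dist ((f ^^ Suc (Suc k)) u) c \<le> dist ((f ^^ Suc k) u) c / 2" by simp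
    then show ?case using Suc zero_le_dist[of "(f ^^ Suc k) u" c] by linarith
  qed
  define t where "t = min (\<delta> / (2 * \<rho>)) (1/2)"
  have t: "0 < t" "t \<le> 1/2" "t * \<rho> \<le> \<delta> / 2"
    using \<delta>(1) \<open>\<rho> > 0\<close> by (auto simp: t_def min_def field_simps)
  \<comment> \<open>A point of \<open>D\<close> on the segment from \<open>c\<close> to \<open>z0\<close>, so near to \<open>c\<close> that even points at \<open>3/2\<close> times
      its distance from \<open>c\<close> are attracted.\<close>
  define w where "w = c + of_real t * (z0 - c)"
  have wc: "dist w c = t * \<rho>" using t by (simp add: w_def dist_norm \<rho>_def norm_mult)
  have "w \<in> D"
  proof -
    have "w - z0 = of_real (1 - t) * (c - z0)" by (simp add: w_def algebra_simps)
    then have "dist z0 w = (1 - t) * \<rho>"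
      using t by (simp add: dist_norm norm_minus_commute \<rho>_def norm_mult del: of_real_diff)
    then show ?thesis using t \<open>\<rho> > 0\<close> by (simp add: D_def)
  qed
  have "(\<lambda>i. dist (g (l (s i)) w) c) \<longlonglongrightarrow> dist w c"
    using limH[OF \<open>w \<in> D\<close>] H_id[OF \<open>w \<in> D\<close>] by (intro tendsto_intros) simp
  moreover have "dist w c < 3/2 * (t * \<rho>)" using wc t \<open>\<rho> > 0\<close> by simp
  ultimately have "eventually (\<lambda>i. dist (g (l (s i)) w) c < 3/2 * (t * \<rho>)) sequentially"
    by (rule order_tendstoD)
  then obtain i where i: "dist (g (l (s i)) w) c < 3/2 * (t * \<rho>)"
    using eventually_happens' sequentially_bot by blast
  obtain k where k: "l (s i) = Suc k" using l(1)[of "s i"] by (cases "l (s i)") auto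
  have "dist (g (l (s i)) w) c \<le> \<delta>" using i t(3) \<delta>(1) by argo
  from contract[OF this, of k] have "dist w c \<le> dist (g (l (s i)) w) c / 2"
    using iterate[OF \<open>w \<in> D\<close>, of "l (s i)"] by (simp only: k)
  moreover have "0 < t * \<rho>" using t \<open>\<rho> > 0\<close> by simp
  ultimately show False using i wc by argo
qed

section \<open>Polynomials attached to a rational map\<close>

text \<open>
  The numerator of the derivative of \<open>p / q\<close>. If \<open>p\<close> and \<open>q\<close> have no common root, its roots are
  the finite critical points of the rational map, including those at poles.
\<close>

definition wronskian :: "'a::idom poly \<Rightarrow> 'a poly \<Rightarrow> 'a poly" where
  "wronskian p q = pderiv p * q - p * pderiv q"

text \<open>
  If \<open>p\<close> and \<open>q\<close> have no common root, the roots of this polynomial are the finite fixed points of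
  the rational map.
\<close>

definition fixed_point_poly :: "'a::idom poly \<Rightarrow> 'a poly \<Rightarrow> 'a poly" where
  "fixed_point_poly p q = p - [:0, 1:] * q"

text \<open>
  Equivalent to coprimality over the complex numbers, but easier to carry through a change of
  coordinates.
\<close>

definition no_common_root :: "'a::idom poly \<Rightarrow> 'a poly \<Rightarrow> bool" where
  "no_common_root p q \<longleftrightarrow> (\<forall>z. poly p z \<noteq> 0 \<or> poly q z \<noteq> 0)"

lemma card_roots_rsquarefree:
  fixes p :: "complex poly"
  assumes "p \<noteq> 0" "\<And>z. poly p z = 0 \<Longrightarrow> poly (pderiv p) z \<noteq> 0"
  shows "card {z. poly p z = 0} = degree p"
proof -
  have "rsquarefree p" using assms by (auto simp: rsquarefree_roots)
  have "degree p = degree (smult (lead_coeff p) (\<Prod>z|poly p z = 0. [:-z, 1:]))"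
    using complex_poly_decompose_rsquarefree[OF \<open>rsquarefree p\<close>] by simp
  also have "\<dots> = card {z. poly p z = 0}"
    using \<open>p \<noteq> 0\<close> by (simp add: degree_prod_sum_eq)
  finally show ?thesis ..
qed

text \<open>
  The sum of the residues of \<open>q / F\<close> when that quotient decays faster than \<open>1 / z\<close>. Lagrange
  interpolation at the roots of \<open>F\<close> reproduces \<open>q\<close>, and the sum is, up to the leading coefficient
  of \<open>F\<close>, the coefficient of \<open>q\<close> of index \<open>degree F - 1\<close>, which vanishes.
\<close>

lemma sum_over_simple_roots_eq_0:
  fixes F q :: "complex poly"
  assumes "degree F > 0" and simple: "\<And>z. poly F z = 0 \<Longrightarrow> poly (pderiv F) z \<noteq> 0"
    and "degree q + 1 < degree F"
  shows "(\<Sum>a | poly F a = 0. poly q a / poly (pderiv F) a) = 0"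
proof -
  define A where "A = {a. poly F a = 0}"
  have F0: "F \<noteq> 0" using \<open>degree F > 0\<close> by auto
  have A: "finite A" "card A = degree F"
    using F0 simple poly_roots_finite card_roots_rsquarefree by (auto simp: A_def)
  have "\<exists>K. F = [:-a, 1:] * K" if "a \<in> A" for a
    using that unfolding A_def by (metis mem_Collect_eq poly_eq_0_iff_dvd dvdE)
  then obtain K where K: "\<And>a. a \<in> A \<Longrightarrow> F = [:-a, 1:] * K a" by metis
  define x where "x a = poly q a / poly (pderiv F) a" for a
  define G where "G = (\<Sum>a\<in>A. smult (x a) (K a))"
  have K_at: "poly (K a) a = poly (pderiv F) a" if "a \<in> A" for a
  proof -
    have "poly (pderiv ([:-a, 1:] * K a)) a = poly (K a) a"
      by (simp only: pderiv_mult) (simp add: pderiv_pCons)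
    then show ?thesis unfolding K[OF that, symmetric] by simp
  qed
  have K_off: "poly (K a) b = 0" if "a \<in> A" "b \<in> A" "a \<noteq> b" for a b
  proof -
    have "poly ([:-a, 1:] * K a) b = 0" using K[OF that(1)] that(2) by (simp add: A_def)
    then show ?thesis using that by simp
  qed
  have degK: "degree (K a) = degree F - 1" "lead_coeff (K a) = lead_coeff F" if "a \<in> A" for a
  proof -
    have "K a \<noteq> 0" using K[OF that] F0 by auto
    then have "degree ([:-a, 1:] * K a) = 1 + degree (K a)" by (subst degree_mult_eq) auto
    then show "degree (K a) = degree F - 1" using K[OF that] by simp
    have "lead_coeff ([:-a, 1:] * K a) = lead_coeff (K a)" by (simp only: lead_coeff_mult) simp
    then show "lead_coeff (K a) = lead_coeff F" using K[OF that] by simp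
  qed
  have "G = q"
  proof (rule poly_eqI_degree[of A])
    fix b assume b: "b \<in> A"
    have "poly G b = (\<Sum>a\<in>A. x a * poly (K a) b)" by (simp add: G_def poly_sum)
    also have "\<dots> = (\<Sum>a\<in>A. if a = b then poly q b else 0)"
      using b K_at K_off simple by (intro sum.cong) (auto simp: x_def A_def)
    finally show "poly G b = poly q b" using A(1) b by simp
  next
    have "degree G \<le> degree F - 1" unfolding G_def
      using A(1) degK(1) by (intro degree_sum_le) (auto intro: order_trans[OF degree_smult_le])
    then show "degree G < card A" using A(2) \<open>degree F > 0\<close> by linarith
    show "degree q < card A" using A(2) assms(3) by simp
  qed
  then have "coeff G (degree F - 1) = 0" using assms(3) by (simp add: coeff_eq_0)
  moreover have "coeff G (degree F - 1) = (\<Sum>a\<in>A. x a * lead_coeff F)"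
    unfolding G_def coeff_sum using degK by (intro sum.cong) auto
  ultimately have "(\<Sum>a\<in>A. x a) * lead_coeff F = 0" by (simp add: sum_distrib_right)
  then show ?thesis using F0 by (simp add: x_def A_def)
qed

text \<open>
  The leading terms of the two products have coefficients proportional to \<open>degree p\<close> and
  \<open>degree q\<close>, so they do not cancel.
\<close>

lemma degree_wronskian:
  fixes p q :: "'a :: {idom, ring_char_0} poly"
  assumes "degree q < degree p" "q \<noteq> 0"
  shows "degree (wronskian p q) = degree p + degree q - 1"
proof -
  define n d where "n = degree p" and "d = degree q"
  have "n \<ge> 1" "p \<noteq> 0" using assms by (auto simp: n_def)
  have le1: "degree (pderiv p * q) \<le> n + d - 1"
    using degree_mult_le[of "pderiv p" q] \<open>n \<ge> 1\<close> by (simp add: degree_pderiv n_def d_def)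
  have c1: "coeff (pderiv p * q) (n + d - 1) = of_nat n * lead_coeff p * lead_coeff q"
    using coeff_mult_degree_sum[of "pderiv p" q] \<open>n \<ge> 1\<close>
    by (simp add: degree_pderiv n_def d_def coeff_pderiv del: of_nat_Suc)
  have le2: "degree (p * pderiv q) \<le> n + d - 1"
  proof (cases "d = 0")
    case True
    then have "pderiv q = 0" by (simp add: d_def pderiv_eq_0_iff)
    then show ?thesis by simp
  next
    case False
    then show ?thesis using degree_mult_le[of p "pderiv q"] by (simp add: degree_pderiv n_def d_def)
  qed
  have c2: "coeff (p * pderiv q) (n + d - 1) = of_nat d * lead_coeff p * lead_coeff q"
  proof (cases "d = 0")
    case True
    then have "pderiv q = 0" by (simp add: d_def pderiv_eq_0_iff)
    then show ?thesis using True by simp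
  next
    case False
    then show ?thesis using coeff_mult_degree_sum[of p "pderiv q"]
      by (simp add: degree_pderiv n_def d_def coeff_pderiv del: of_nat_Suc)
  qed
  have "coeff (wronskian p q) (n + d - 1) = (of_nat n - of_nat d) * lead_coeff p * lead_coeff q"
    by (simp only: wronskian_def coeff_diff c1 c2 left_diff_distrib)
  also have "\<dots> \<noteq> 0" using assms \<open>p \<noteq> 0\<close> by (simp add: n_def d_def)
  finally have "degree (wronskian p q) \<ge> n + d - 1" by (rule le_degree)
  moreover have "degree (wronskian p q) \<le> n + d - 1"
    unfolding wronskian_def using le1 le2 degree_diff_le by blast
  ultimately show ?thesis by (simp add: n_def d_def)
qed

lemma DERIV_quotient_poly:
  fixes p q :: "complex poly"
  assumes "poly q z \<noteq> 0"
  shows "((\<lambda>z. poly p z / poly q z) has_field_derivative poly (wronskian p q) z / (poly q z)\<^sup>2) (at z)"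
  using DERIV_divide[OF poly_DERIV poly_DERIV assms, of p] by (simp add: wronskian_def power2_eq_square)

text \<open>
  At a root of \<open>fixed_point_poly p q\<close>, division by \<open>q\<^sup>2\<close> turns this identity into the formula
  that links the multiplier to the derivative of the fixed point polynomial.
\<close>

lemma wronskian_eq_fixed_point_poly:
  "wronskian p q = q ^ 2 + pderiv (fixed_point_poly p q) * q - fixed_point_poly p q * pderiv q"
proof -
  have "wronskian p q = q ^ 2 + pderiv (p - X * q) * q - (p - X * q) * pderiv q" if "pderiv X = 1" for X
    using that by (simp add: wronskian_def pderiv_diff pderiv_mult power2_eq_square algebra_simps)
  moreover have "pderiv [:0, 1 :: 'a:] = 1" by (simp add: pderiv_pCons)
  ultimately show ?thesis unfolding fixed_point_poly_def .
qed

lemma attracting_if_deriv_zero: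
  fixes f :: "complex \<Rightarrow> complex"
  assumes "(f has_field_derivative 0) (at c)" "f c = c"
  shows "\<exists>\<delta>>0. \<forall>u. dist u c \<le> \<delta> \<longrightarrow> dist (f u) c \<le> dist u c / 2"
proof -
  have "\<forall>e>0. \<exists>d>0. \<forall>y. norm (y - c) < d \<longrightarrow> norm (f y - f c - 0 * (y - c)) \<le> e * norm (y - c)"
    using assms(1) unfolding has_field_derivative_def has_derivative_at_alt by (rule conjunct2)
  from this[rule_format, of "1/2"] obtain d where d: "d > 0"
      "\<And>y. norm (y - c) < d \<Longrightarrow> norm (f y - f c - 0 * (y - c)) \<le> 1/2 * norm (y - c)"
    by auto
  have "dist (f u) c \<le> dist u c / 2" if "dist u c \<le> d / 2" for u
    using d(2)[of u] that \<open>d > 0\<close> assms(2) by (simp add: dist_norm)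
  then show ?thesis using \<open>d > 0\<close> half_gt_zero by blast
qed

text \<open>
  If \<open>degree q < degree p\<close>, then infinity is fixed and a finite value \<open>z\<close> is taken exactly at the
  roots of \<open>p - z q\<close>, a polynomial of degree \<open>degree p\<close>. A multiple root would be a critical point,
  hence fixed, so that \<open>z\<close> would be that critical point. Outside the critical points all fibres
  therefore have the same number of points. Removing from the domain the preimages of the critical
  points also removes the critical points, because they are their own images.
\<close>

lemma covering_space_rational:
  fixes p q :: "complex poly"
  defines "C \<equiv> {c. poly (wronskian p q) c = 0}" and "f \<equiv> \<lambda>z. poly p z / poly q z"
  defines "T \<equiv> {z. poly q z \<noteq> 0 \<and> f z \<notin> C}"
  assumes nc: "no_common_root p q" and deg: "degree q < degree p" "q \<noteq> 0"
    and crit: "\<And>c. c \<in> C \<Longrightarrow> poly p c = c * poly q c"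
  shows "covering_space T f (- C)" "open T" "T \<subseteq> - C" "f holomorphic_on T" "finite C"
proof -
  define W where "W = wronskian p q"
  have "W \<noteq> 0"
  proof
    assume "W = 0"
    then have "poly p z = z * poly q z" for z using crit by (simp add: W_def C_def)
    then have "poly p z = poly ([:0, 1:] * q) z" for z by simp
    then have pq: "p = [:0, 1:] * q" by (metis poly_eq_poly_eq_iff ext)
    have "degree p + degree q - 1 = 0" using degree_wronskian[OF deg] \<open>W = 0\<close> by (simp add: W_def)
    then have "degree q = 0" "degree p = 1" using deg by auto
    then obtain k where "q = [:k:]" using degree_eq_zeroE by blast
    then show False using pq \<open>W = 0\<close> \<open>q \<noteq> 0\<close> by (simp add: W_def wronskian_def pderiv_pCons)
  qed
  then show "finite C" by (simp add: C_def W_def poly_roots_finite)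
  have derivf: "(f has_field_derivative poly W z / (poly q z)\<^sup>2) (at z)" if "poly q z \<noteq> 0" for z
    unfolding f_def W_def by (rule DERIV_quotient_poly[OF that])
  have critical_pole: "poly q c \<noteq> 0" if "c \<in> C" for c
    using crit[OF that] nc by (auto simp: no_common_root_def)
  show TC: "T \<subseteq> - C" using crit critical_pole by (force simp: T_def f_def)
  have opq: "open {z. poly q z \<noteq> 0}" by (intro open_Collect_neq continuous_intros)
  have contf: "continuous_on {z. poly q z \<noteq> 0} f" unfolding f_def by (intro continuous_intros) auto
  have "open ({z. poly q z \<noteq> 0} \<inter> f -` (- C))"
    using \<open>finite C\<close> by (intro continuous_open_preimage[OF contf opq]) (auto intro: finite_imp_closed)
  moreover have "{z. poly q z \<noteq> 0} \<inter> f -` (- C) = T" by (auto simp: T_def)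
  ultimately show "open T" by simp
  show hol: "f holomorphic_on T" unfolding f_def by (intro holomorphic_intros) (auto simp: T_def)
  show "covering_space T f (- C)"
  proof (rule covering_space_if_constant_fibre_card[OF \<open>open T\<close> hol])
    show "f ` T \<subseteq> - C" by (auto simp: T_def)
    show "deriv f w \<noteq> 0" if "w \<in> T" for w
      using DERIV_imp_deriv[OF derivf[of w]] that TC by (auto simp: T_def C_def W_def)
    show "degree p > 0" using deg by simp
    fix z assume z: "z \<in> - C"
    define P where "P = p - smult z q"
    have degP: "degree P = degree p"
    proof -
      have "degree (- smult z q) < degree p" using degree_smult_le[of z q] deg by simp
      from degree_add_eq_left[OF this] show ?thesis by (simp add: P_def)
    qed
    have root: "poly q w \<noteq> 0 \<and> f w = z" if "poly P w = 0" for w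
    proof -
      have "poly p w = z * poly q w" using that by (simp add: P_def)
      then show ?thesis using nc by (auto simp: no_common_root_def f_def)
    qed
    have "poly P w = 0" if "w \<in> T" "f w = z" for w
      using that by (simp add: T_def P_def f_def field_simps)
    then have "{w \<in> T. f w = z} = {w. poly P w = 0}"
      using root z by (auto simp: T_def)
    moreover have "poly (pderiv P) w \<noteq> 0" if w: "poly P w = 0" for w
    proof
      assume "poly (pderiv P) w = 0"
      then have "poly (pderiv p) w = z * poly (pderiv q) w" "poly p w = z * poly q w"
        using w by (simp_all add: P_def pderiv_diff pderiv_smult)
      then have "w \<in> C" by (simp add: C_def wronskian_def)
      then have "f w = w" using crit critical_pole by (simp add: f_def)
      then show False using root[OF w] z \<open>w \<in> C\<close> by simp
    qed
    moreover have "P \<noteq> 0" using degP deg by auto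
    ultimately show "card {w \<in> T. f w = z} = degree p"
      using card_roots_rsquarefree[of P] degP by simp
  qed
qed

text \<open>
  The case where too few values are omitted for a normal families argument. If \<open>c\<close> is the only
  finite critical point, the Wronskian vanishes at \<open>c\<close> to order \<open>degree p + degree q - 1\<close>, so \<open>p - c q\<close>
  vanishes there to order at least \<open>degree p + degree q\<close>. Its degree is only \<open>degree p\<close>; hence \<open>q\<close> is
  constant and \<open>p - c q\<close> is a monomial in \<open>z - c\<close>.
\<close>

lemma monomial_if_one_critical_point:
  fixes p q :: "complex poly"
  assumes deg: "degree q < degree p" "q \<noteq> 0"
    and W: "{c. poly (wronskian p q) c = 0} = {c}" and c: "poly p c = c * poly q c" "poly q c \<noteq> 0"
  obtains \<alpha> where "\<alpha> \<noteq> 0" "\<And>z. poly q z \<noteq> 0" "\<And>z. poly p z / poly q z = c + \<alpha> * (z - c) ^ degree p"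
proof -
  define V where "V = wronskian p q"
  define n d where "n = degree p" and "d = degree q"
  have "finite {z. poly V z = 0}" using W by (simp add: V_def)
  then have "V \<noteq> 0" using infinite_UNIV_char_0[where 'a = complex] by auto
  have roots: "{z. poly V z = 0} = {c}" using W by (simp add: V_def)
  have "degree V = order c V"
  proof -
    have "degree V = degree (smult (lead_coeff V) ([:-c, 1:] ^ order c V))"
      using complex_poly_decompose[of V] roots by simp
    then show ?thesis using \<open>V \<noteq> 0\<close> by (simp add: degree_power_eq)
  qed
  then have ordV: "order c V = n + d - 1"
    using degree_wronskian[OF deg] by (simp add: V_def n_def d_def)
  define P where "P = p - smult c q"
  have degP: "degree P = n"
  proof -
    have "degree (- smult c q) < degree p" using degree_smult_le[of c q] deg by simp
    from degree_add_eq_left[OF this] show ?thesis by (simp add: P_def n_def)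
  qed
  have "P \<noteq> 0" using degP deg by (auto simp: n_def)
  have "poly P c = 0" by (simp add: P_def c)
  define k where "k = order c P"
  have k: "k = Suc (order c (pderiv P))"
    using order_pderiv[OF \<open>P \<noteq> 0\<close> \<open>poly P c = 0\<close>] by (simp add: k_def)
  have VP: "V = pderiv P * q - P * pderiv q"
    by (simp add: V_def wronskian_def P_def pderiv_diff pderiv_smult algebra_simps)
  have "pderiv P \<noteq> 0" using degP deg by (auto simp: n_def pderiv_eq_0_iff)
  have "k \<ge> n + d"
  proof (rule ccontr)
    assume "\<not> k \<ge> n + d"
    then have "[:-c, 1:] ^ k dvd V" using ordV by (auto simp: order_divides)
    moreover have "[:-c, 1:] ^ k dvd P * pderiv q" unfolding k_def by (rule dvd_mult2[OF order_1])
    moreover have "pderiv P * q = V + P * pderiv q" by (simp add: VP)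
    ultimately have "[:-c, 1:] ^ k dvd pderiv P * q" by simp
    then have "k \<le> order c (pderiv P * q)"
      using \<open>pderiv P \<noteq> 0\<close> \<open>q \<noteq> 0\<close> by (simp add: order_divides)
    also have "\<dots> = order c (pderiv P)"
      using \<open>pderiv P \<noteq> 0\<close> \<open>q \<noteq> 0\<close> c(2) by (simp add: order_mult order_0I)
    finally show False using k by simp
  qed
  moreover have "k \<le> n" using order_degree[OF \<open>P \<noteq> 0\<close>] degP by (simp add: k_def)
  ultimately have "d = 0" "k = n" by auto
  then obtain \<beta> where q: "q = [:\<beta>:]" unfolding d_def by (metis degree_eq_zeroE)
  then have \<beta>: "q = [:\<beta>:]" "\<beta> \<noteq> 0" using \<open>q \<noteq> 0\<close> by auto
  obtain S where S: "P = [:-c, 1:] ^ n * S" using order_1[of c P] \<open>k = n\<close> by (auto simp: k_def)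
  then have "S \<noteq> 0" using \<open>P \<noteq> 0\<close> by auto
  then have "degree P = n + degree S" using S by (simp add: degree_mult_eq degree_power_eq)
  then have "degree S = 0" using degP by simp
  then obtain \<sigma> where "S = [:\<sigma>:]" by (metis degree_eq_zeroE)
  then have \<sigma>: "S = [:\<sigma>:]" "\<sigma> \<noteq> 0" using \<open>S \<noteq> 0\<close> by auto
  show thesis
  proof
    show "\<sigma> / \<beta> \<noteq> 0" "poly q z \<noteq> 0" for z using \<beta> \<sigma> by auto
    fix z
    have "poly p z - c * \<beta> = (z - c) ^ n * \<sigma>"
      using arg_cong[OF S, of "\<lambda>r. poly r z"] \<sigma> \<beta> by (simp add: P_def)
    then show "poly p z / poly q z = c + \<sigma> / \<beta> * (z - c) ^ degree p"
      using \<beta> by (simp add: n_def field_simps)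
  qed
qed

section \<open>Local derivatives on the sphere\<close>

text \<open>
  A relational form of \<open>local_deriv\<close>. Since \<open>coord b\<close> takes a dummy value outside its domain,
  differentiability of the coordinate expression alone does not ensure that \<open>f\<close> maps points near
  \<open>a\<close> into the domain of the coordinate at \<open>f a\<close>. The first conjunct says so, and this makes the
  chain rule valid.
\<close>

definition has_local_deriv :: "(riemann_sphere \<Rightarrow> riemann_sphere) \<Rightarrow> riemann_sphere \<Rightarrow> complex \<Rightarrow> bool" where
  "has_local_deriv f a D \<longleftrightarrow>
     (\<forall>\<^sub>F w in nhds (coord a a). coord_inv (f a) (coord (f a) (f (coord_inv a w))) = f (coord_inv a w)) \<and>
     ((\<lambda>w. coord (f a) (f (coord_inv a w))) has_field_derivative D) (at (coord a a))"

lemma coord_inv_coord_self: "coord_inv a (coord a a) = a"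
  by (cases a) auto

lemma has_local_deriv_imp_local_deriv: "has_local_deriv f a D \<Longrightarrow> local_deriv f a = D"
  unfolding has_local_deriv_def local_deriv_def by (blast intro: DERIV_imp_deriv)

lemma has_local_deriv_id: "has_local_deriv (\<lambda>x. x) a 1"
proof (cases a)
  case (Fin z)
  then show ?thesis by (auto simp: has_local_deriv_def intro!: derivative_eq_intros)
next
  case Infty
  have "(\<lambda>w. coord Infty (coord_inv Infty w)) = (\<lambda>w. w)" by (auto simp: fun_eq_iff)
  then show ?thesis using Infty by (auto simp: has_local_deriv_def intro!: derivative_eq_intros)
qed

lemma has_field_derivative_eventually_eq:
  "\<forall>\<^sub>F w in nhds x. f w = g w \<Longrightarrow> (g has_field_derivative D) (at x) \<Longrightarrow> (f has_field_derivative D) (at x)"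
  by (rule DERIV_cong_ev[THEN iffD2, OF refl _ refl])

lemma has_local_deriv_compose:
  assumes f: "has_local_deriv f a D" and g: "has_local_deriv g (f a) E"
  shows "has_local_deriv (g \<circ> f) a (E * D)"
proof -
  define \<phi> where "\<phi> w = coord (f a) (f (coord_inv a w))" for w
  define \<psi> where "\<psi> u = coord (g (f a)) (g (coord_inv (f a) u))" for u
  have d\<phi>: "(\<phi> has_field_derivative D) (at (coord a a))"
    and ev\<phi>: "\<forall>\<^sub>F w in nhds (coord a a). coord_inv (f a) (\<phi> w) = f (coord_inv a w)"
    using f by (simp_all add: has_local_deriv_def \<phi>_def[abs_def])
  have \<phi>a: "\<phi> (coord a a) = coord (f a) (f a)" by (simp add: \<phi>_def coord_inv_coord_self)
  have d\<psi>: "(\<psi> has_field_derivative E) (at (\<phi> (coord a a)))"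
    and ev\<psi>: "\<forall>\<^sub>F u in nhds (\<phi> (coord a a)). coord_inv (g (f a)) (\<psi> u) = g (coord_inv (f a) u)"
    using g by (simp_all add: has_local_deriv_def \<psi>_def[abs_def] \<phi>a)
  have "isCont \<phi> (coord a a)" using d\<phi> DERIV_isCont by blast
  then have "\<forall>\<^sub>F w in nhds (coord a a). coord_inv (g (f a)) (\<psi> (\<phi> w)) = g (coord_inv (f a) (\<phi> w))"
    using eventually_compose_filterlim[OF ev\<psi>] by (simp add: isCont_def tendsto_at_iff_tendsto_nhds)
  then have comp: "\<forall>\<^sub>F w in nhds (coord a a).
      coord (g (f a)) (g (f (coord_inv a w))) = \<psi> (\<phi> w) \<and>
      coord_inv (g (f a)) (\<psi> (\<phi> w)) = g (f (coord_inv a w))"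
    using ev\<phi> by eventually_elim (simp add: \<psi>_def)
  have "((\<lambda>w. \<psi> (\<phi> w)) has_field_derivative E * D) (at (coord a a))"
    using DERIV_chain2[OF d\<psi> d\<phi>] .
  moreover have "\<forall>\<^sub>F w in nhds (coord a a). coord (g (f a)) (g (f (coord_inv a w))) = \<psi> (\<phi> w)"
    using comp by eventually_elim simp
  ultimately have "((\<lambda>w. coord (g (f a)) (g (f (coord_inv a w)))) has_field_derivative E * D) (at (coord a a))"
    by (rule has_field_derivative_eventually_eq[rotated])
  moreover have "\<forall>\<^sub>F w in nhds (coord a a).
      coord_inv (g (f a)) (coord (g (f a)) (g (f (coord_inv a w)))) = g (f (coord_inv a w))"
    using comp by eventually_elim simp
  ultimately show ?thesis by (simp add: has_local_deriv_def)
qed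

lemma wronskian_swap: "wronskian q p = - wronskian p q"
  by (simp add: wronskian_def algebra_simps)

lemma eventually_poly_nonzero:
  fixes p :: "complex poly"
  assumes "poly p a \<noteq> 0"
  shows "\<forall>\<^sub>F w in nhds a. poly p w \<noteq> 0"
proof -
  have "open {w. poly p w \<noteq> 0}" by (intro open_Collect_neq continuous_intros)
  then show ?thesis using assms eventually_nhds_in_open[of "{w. poly p w \<noteq> 0}" a] by simp
qed

lemma rational_fun_has_local_deriv_Fin:
  assumes "poly q a \<noteq> 0"
  shows "has_local_deriv (rational_fun p q) (Fin a) (poly (wronskian p q) a / (poly q a)\<^sup>2)"
proof -
  have ev: "\<forall>\<^sub>F w in nhds a. rational_fun p q (Fin w) = Fin (poly p w / poly q w)"
    using eventually_poly_nonzero[OF assms] by eventually_elim simp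
  then have "\<forall>\<^sub>F w in nhds a. coord (Fin b) (rational_fun p q (Fin w)) = poly p w / poly q w" for b
    by eventually_elim simp
  then have "((\<lambda>w. coord (Fin b) (rational_fun p q (Fin w))) has_field_derivative
      poly (wronskian p q) a / (poly q a)\<^sup>2) (at a)" for b
    by (rule has_field_derivative_eventually_eq[OF _ DERIV_quotient_poly[OF assms]])
  moreover have "\<forall>\<^sub>F w in nhds a. Fin (coord (Fin b) (rational_fun p q (Fin w))) = rational_fun p q (Fin w)" for b
    using ev by eventually_elim simp
  ultimately show ?thesis using assms by (simp add: has_local_deriv_def)
qed

lemma rational_fun_has_local_deriv_pole:
  assumes "poly q a = 0" "poly p a \<noteq> 0"
  shows "has_local_deriv (rational_fun p q) (Fin a) (- poly (wronskian p q) a / (poly p a)\<^sup>2)"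
proof -
  have nz: "\<forall>\<^sub>F w in nhds a. poly p w \<noteq> 0" using eventually_poly_nonzero[OF assms(2)] .
  then have "\<forall>\<^sub>F w in nhds a. coord Infty (rational_fun p q (Fin w)) = poly q w / poly p w"
    by eventually_elim simp
  moreover have "((\<lambda>w. poly q w / poly p w) has_field_derivative - poly (wronskian p q) a / (poly p a)\<^sup>2) (at a)"
    using DERIV_quotient_poly[OF assms(2), of q] by (simp add: wronskian_swap[of q p])
  ultimately have "((\<lambda>w. coord Infty (rational_fun p q (Fin w))) has_field_derivative
      - poly (wronskian p q) a / (poly p a)\<^sup>2) (at a)"
    by (rule has_field_derivative_eventually_eq)
  moreover have "\<forall>\<^sub>F w in nhds a. coord_inv Infty (coord Infty (rational_fun p q (Fin w))) = rational_fun p q (Fin w)"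
    using nz by eventually_elim simp
  ultimately show ?thesis using assms by (simp add: has_local_deriv_def)
qed

text \<open>
  The reversed polynomial \<open>z ^ n * p (1 / z)\<close>, which describes behaviour at infinity. The formal
  degree \<open>n\<close> has to be explicit, because numerator and denominator of a rational map are reversed
  with the same \<open>n\<close> but may have different degrees.
\<close>

definition reversal :: "nat \<Rightarrow> 'a::field poly \<Rightarrow> 'a poly" where
  "reversal n p = monom 1 (n - degree p) * reflect_poly p"

lemma coeff_reversal:
  assumes "degree p \<le> n"
  shows "coeff (reversal n p) i = (if i \<le> n then coeff p (n - i) else 0)"
  using assms by (auto simp: reversal_def coeff_monom_mult coeff_reflect_poly coeff_eq_0 not_less
      intro!: arg_cong[of _ _ "coeff p"])

lemma poly_reversal:
  assumes "degree p \<le> n"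
  shows "w \<noteq> 0 \<Longrightarrow> poly (reversal n p) w = w ^ n * poly p (1 / w)"
    and "poly (reversal n p) 0 = coeff p n"
proof -
  show "poly (reversal n p) w = w ^ n * poly p (1 / w)" if "w \<noteq> 0"
    using that assms
    by (simp add: reversal_def poly_monom poly_reflect_poly_nz inverse_eq_divide flip: power_add)
  show "poly (reversal n p) 0 = coeff p n" using assms by (simp add: poly_0_coeff_0 coeff_reversal)
qed

lemma no_common_root_reversal:
  assumes "no_common_root p q" "max (degree p) (degree q) = n" "n > 0"
  shows "no_common_root (reversal n p) (reversal n q)"
  unfolding no_common_root_def
proof
  fix w :: 'a
  have deg: "degree p \<le> n" "degree q \<le> n" using assms(2) by auto
  show "poly (reversal n p) w \<noteq> 0 \<or> poly (reversal n q) w \<noteq> 0"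
  proof (cases "w = 0")
    case True
    have "lead_coeff p \<noteq> 0 \<and> degree p = n \<or> lead_coeff q \<noteq> 0 \<and> degree q = n"
      using assms(2,3) by (auto simp: max_def split: if_splits)
    then show ?thesis using True deg by (auto simp: poly_reversal)
  next
    case False
    then show ?thesis using assms(1) deg by (simp add: poly_reversal no_common_root_def)
  qed
qed

lemma rational_fun_reversal:
  assumes "max (degree p) (degree q) = n"
  shows "rational_fun p q (coord_inv Infty w) = rational_fun (reversal n p) (reversal n q) (Fin w)"
proof -
  have deg: "degree p \<le> n" "degree q \<le> n" using assms(1) by auto
  show ?thesis using assms by (cases "w = 0") (auto simp: poly_reversal[OF deg(1)] poly_reversal[OF deg(2)])
qed

lemma has_local_deriv_Infty_iff:
  assumes "max (degree p) (degree q) = n"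
  shows "has_local_deriv (rational_fun p q) Infty D \<longleftrightarrow>
    has_local_deriv (rational_fun (reversal n p) (reversal n q)) (Fin 0) D"
  using rational_fun_reversal[OF assms] rational_fun_reversal[OF assms, of 0]
  by (simp add: has_local_deriv_def del: rational_fun.simps)

lemma rational_fun_has_local_deriv:
  assumes "no_common_root p q" "max (degree p) (degree q) > 0"
  shows "has_local_deriv (rational_fun p q) a (local_deriv (rational_fun p q) a)"
proof -
  have fin: "\<exists>D. has_local_deriv (rational_fun p q) (Fin b) D" if "no_common_root p q" for p q b
    using that rational_fun_has_local_deriv_Fin rational_fun_has_local_deriv_pole
    unfolding no_common_root_def by blast
  have "\<exists>D. has_local_deriv (rational_fun p q) a D"
  proof (cases a)
    case Infty
    then show ?thesis
      using fin[OF no_common_root_reversal[OF assms(1) refl assms(2)]] has_local_deriv_Infty_iff[OF refl] by blast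
  qed (use fin assms in blast)
  then show ?thesis using has_local_deriv_imp_local_deriv by blast
qed

text \<open>
  In the coordinate \<open>1 / z\<close>, used in source and target, the map is the quotient of the reversal of \<open>q\<close>
  by the reversal of \<open>p\<close>. Its derivative at \<open>0\<close> is proportional to the coefficient of \<open>q\<close> of index
  \<open>n - 1\<close>.
\<close>

lemma critical_fixed_Infty_imp_degree:
  assumes "no_common_root p q" "max (degree p) (degree q) = n" "n > 0"
    and fixed: "rational_fun p q Infty = Infty" and crit: "critical_point (rational_fun p q) Infty"
  shows "degree p = n" "degree q + 1 < n"
proof -
  have deg: "degree p \<le> n" "degree q \<le> n" using assms(2) by auto
  have qn: "coeff q n = 0" using fixed assms(2) by (auto split: if_splits)
  have "degree q \<noteq> n" using qn \<open>n > 0\<close> by auto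
  then have "degree q < n" using deg by simp
  then show "degree p = n" using assms(2) by auto
  then have pn: "coeff p n \<noteq> 0" using \<open>n > 0\<close> by auto
  define P Q where "P = reversal n p" and "Q = reversal n q"
  have "poly Q 0 = 0" "poly P 0 \<noteq> 0" using qn pn deg by (simp_all add: P_def Q_def poly_reversal)
  from rational_fun_has_local_deriv_pole[OF this]
  have "local_deriv (rational_fun p q) Infty = - poly (wronskian P Q) 0 / (poly P 0)\<^sup>2"
    using has_local_deriv_Infty_iff[OF assms(2)] has_local_deriv_imp_local_deriv by (simp add: P_def Q_def)
  then have "poly (wronskian P Q) 0 = 0" using crit \<open>poly P 0 \<noteq> 0\<close> by (simp add: critical_point_def)
  then have "poly (pderiv Q) 0 = 0" using \<open>poly Q 0 = 0\<close> \<open>poly P 0 \<noteq> 0\<close> by (simp add: wronskian_def)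
  then have "coeff Q 1 = 0" by (simp add: poly_0_coeff_0 coeff_pderiv)
  then have q1: "coeff q (n - 1) = 0" using deg \<open>n > 0\<close> by (simp add: Q_def coeff_reversal)
  show "degree q + 1 < n"
  proof (rule ccontr)
    assume "\<not> degree q + 1 < n"
    then have "degree q = n - 1" using \<open>degree q < n\<close> by simp
    then have "q = 0" using q1 by (metis leading_coeff_0_iff)
    then have "n = 1" using \<open>degree q = n - 1\<close> \<open>n > 0\<close> by simp
    have "degree p > 0" using \<open>degree p = n\<close> \<open>n > 0\<close> by simp
    then have "\<not> constant (poly p)" by (simp add: constant_degree)
    from fundamental_theorem_of_algebra[OF this] show False
      using assms(1) \<open>q = 0\<close> by (auto simp: no_common_root_def)
  qed
qed

section \<open>Maps with a critical point at infinity\<close>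

lemma denominator_nonzero:
  fixes p q :: "complex poly"
  assumes "no_common_root p q" "degree p > 0"
  shows "q \<noteq> 0"
proof -
  have "\<not> constant (poly p)" using assms(2) by (simp add: constant_degree)
  from fundamental_theorem_of_algebra[OF this] show ?thesis
    using assms(1) by (auto simp: no_common_root_def)
qed

lemma wronskian_has_root:
  fixes p q :: "complex poly"
  assumes "no_common_root p q" "degree q < degree p" "degree p \<ge> 2"
  shows "\<exists>c. poly (wronskian p q) c = 0"
proof -
  have "degree (wronskian p q) > 0"
    using degree_wronskian[OF assms(2)] denominator_nonzero[OF assms(1)] assms(3) by simp
  then have "\<not> constant (poly (wronskian p q))" by (simp add: constant_degree)
  then show ?thesis by (rule fundamental_theorem_of_algebra)
qed

text \<open>
  Every finite critical point is fixed with derivative \<open>0\<close>, hence attracting. With two finite critical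
  points the normal families argument applies; with just one, the map is \<open>c + \<alpha> (z - c) ^ n\<close> and
  its noncritical finite fixed points have multiplier \<open>n\<close>.
\<close>

lemma finite_fixed_points_repelling:
  fixes p q :: "complex poly"
  assumes nc: "no_common_root p q" and deg: "degree q < degree p" "degree p \<ge> 2"
    and crit: "\<And>c. poly (wronskian p q) c = 0 \<Longrightarrow> poly p c = c * poly q c"
    and z0: "poly p z0 = z0 * poly q z0" "poly (wronskian p q) z0 \<noteq> 0"
  shows "norm (poly (wronskian p q) z0 / (poly q z0)\<^sup>2) > 1"
proof -
  define C where "C = {c. poly (wronskian p q) c = 0}"
  define f where "f = (\<lambda>z. poly p z / poly q z)"
  define T where "T = {z. poly q z \<noteq> 0 \<and> poly p z / poly q z \<notin> C}"
  have "q \<noteq> 0" using denominator_nonzero[OF nc] deg by simp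
  have crit': "poly p c = c * poly q c" if "c \<in> {c. poly (wronskian p q) c = 0}" for c
    using crit that by blast
  note cov = covering_space_rational[OF nc deg(1) \<open>q \<noteq> 0\<close> crit', folded C_def, folded T_def f_def]
  have pole: "poly q z \<noteq> 0" if "poly p z = z * poly q z" for z
    using that nc by (auto simp: no_common_root_def)
  have derivf: "(f has_field_derivative poly (wronskian p q) z / (poly q z)\<^sup>2) (at z)" if "poly q z \<noteq> 0" for z
    unfolding f_def by (rule DERIV_quotient_poly[OF that])
  have fz0: "f z0 = z0" using z0(1) pole by (simp add: f_def)
  have "z0 \<notin> C" using z0(2) by (simp add: C_def)
  obtain c where "c \<in> C" using wronskian_has_root[OF nc deg] by (auto simp: C_def)
  have "norm (deriv f z0) > 1"
  proof (cases "C = {c}")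
    case True
    have pc: "poly p c = c * poly q c" using crit \<open>c \<in> C\<close> by (simp add: C_def)
    obtain \<alpha> where \<alpha>: "\<alpha> \<noteq> 0" "\<And>z. poly q z \<noteq> 0" "\<And>z. poly p z / poly q z = c + \<alpha> * (z - c) ^ degree p"
      using monomial_if_one_critical_point[OF deg(1) \<open>q \<noteq> 0\<close> True[unfolded C_def] pc pole[OF pc]] by metis
    have f: "f = (\<lambda>z. c + \<alpha> * (z - c) ^ degree p)" using \<alpha>(3) by (simp add: f_def)
    obtain k where k: "degree p = Suc k" using deg by (cases "degree p") auto
    have "(f has_field_derivative \<alpha> * (of_nat (Suc k) * (z0 - c) ^ k)) (at z0)"
      unfolding f k
      by (rule DERIV_cong[OF DERIV_add[OF DERIV_const
            DERIV_cmult[OF DERIV_power_Suc[OF DERIV_diff[OF DERIV_ident DERIV_const]]]]]) simp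
    moreover have "\<alpha> * (z0 - c) ^ k = 1"
    proof -
      have "\<alpha> * (z0 - c) ^ k * (z0 - c) = 1 * (z0 - c)" using fz0 by (simp add: f k algebra_simps)
      then show ?thesis using \<open>z0 \<notin> C\<close> \<open>c \<in> C\<close> by (metis mult_right_cancel right_minus_eq)
    qed
    ultimately have "(f has_field_derivative of_nat (Suc k)) (at z0)"
      by (metis mult.left_commute mult.right_neutral)
    then have "deriv f z0 = of_nat (Suc k)" by (rule DERIV_imp_deriv)
    then have "norm (deriv f z0) = real (Suc k)" by (simp only: norm_of_nat)
    then show ?thesis using deg k by simp
  next
    case False
    then obtain b where b: "b \<in> C" "c \<noteq> b" using \<open>c \<in> C\<close> by auto
    show ?thesis
    proof (rule norm_deriv_gt_1_at_fixed_point[OF cov(1-5) \<open>c \<in> C\<close> b _ _ fz0])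
      show "z0 \<in> T" using fz0 \<open>z0 \<notin> C\<close> pole[OF z0(1)] by (simp add: T_def f_def)
      fix a assume "a \<in> C"
      then have a: "poly p a = a * poly q a" "poly q a \<noteq> 0" "poly (wronskian p q) a = 0"
        using crit pole by (auto simp: C_def)
      show "\<exists>\<delta>>0. \<forall>u. dist u a \<le> \<delta> \<longrightarrow> dist (f u) a \<le> dist u a / 2"
        by (rule attracting_if_deriv_zero) (use derivf[OF a(2)] a in \<open>auto simp: f_def\<close>)
    qed
  qed
  then show ?thesis using DERIV_imp_deriv[OF derivf[OF pole[OF z0(1)]]] by simp
qed

lemma critical_point_Fin_iff:
  assumes "no_common_root p q"
  shows "critical_point (rational_fun p q) (Fin a) \<longleftrightarrow> poly (wronskian p q) a = 0"
proof (cases "poly q a = 0")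
  case True
  then have "poly p a \<noteq> 0" using assms by (auto simp: no_common_root_def)
  then show ?thesis
    using has_local_deriv_imp_local_deriv[OF rational_fun_has_local_deriv_pole[OF True]]
    by (simp add: critical_point_def)
next
  case False
  then show ?thesis
    using has_local_deriv_imp_local_deriv[OF rational_fun_has_local_deriv_Fin[OF False]]
    by (simp add: critical_point_def)
qed

lemma fixed_point_Fin_iff:
  assumes "no_common_root p q"
  shows "fixed_point (rational_fun p q) (Fin a) \<longleftrightarrow> poly p a = a * poly q a"
  using assms by (auto simp: fixed_point_def no_common_root_def field_simps)

text \<open>
  With a critical point at infinity the numerator exceeds the denominator in degree by at least
  \<open>2\<close>. The fixed points are then infinity and the \<open>n\<close> roots of the fixed point polynomial, which are
  simple because no multiplier equals \<open>1\<close>. The terms \<open>1 / (1 - \<mu>)\<close> of the finite fixed points are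
  residues of a rational function that decays at least as fast as \<open>1 / z\<^sup>2\<close>, so they sum to \<open>0\<close>;
  infinity, with multiplier \<open>0\<close>, contributes the \<open>1\<close>.
\<close>

lemma normal_form_fixed_points:
  fixes p q :: "complex poly"
  defines "R \<equiv> rational_fun p q"
  assumes nc: "no_common_root p q" and deg: "max (degree p) (degree q) = n" and "n \<ge> 2"
    and crit_fixed: "\<And>z. critical_point R z \<Longrightarrow> fixed_point R z" and Infty: "critical_point R Infty"
  shows "card {z. fixed_point R z} = n + 1"
    and "\<And>z. fixed_point R z \<Longrightarrow> \<not> critical_point R z \<Longrightarrow> norm (multiplier R z) > 1"
    and "(\<Sum>z | fixed_point R z. 1 / (1 - multiplier R z)) = 1"
proof -
  have RInfty: "R Infty = Infty" using crit_fixed[OF Infty] by (simp add: fixed_point_def)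
  have degp: "degree p = n" and degq: "degree q + 1 < n"
    using critical_fixed_Infty_imp_degree[OF nc deg] RInfty Infty \<open>n \<ge> 2\<close> by (auto simp: R_def)
  define F where "F = fixed_point_poly p q"
  have polyF: "poly F a = poly p a - a * poly q a" for a by (simp add: F_def fixed_point_poly_def)
  have "degree ([:0, 1:] * q) < degree p"
    using degree_mult_le[of "[:0, 1:]" q] degp degq by simp
  then have "degree (- ([:0, 1:] * q)) < degree p" by (simp only: degree_minus)
  from degree_add_eq_left[OF this] have degF: "degree F = n"
    by (simp only: F_def fixed_point_poly_def degp diff_conv_add_uminus)
  define A where "A = {a. poly F a = 0}"
  have fixA: "fixed_point R (Fin a) \<longleftrightarrow> a \<in> A" for a
    unfolding R_def fixed_point_Fin_iff[OF nc] by (simp add: A_def polyF)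
  have fixed: "{z. fixed_point R z} = insert Infty (Fin ` A)"
  proof (rule set_eqI)
    fix z show "z \<in> {z. fixed_point R z} \<longleftrightarrow> z \<in> insert Infty (Fin ` A)"
      by (cases z) (use fixA crit_fixed[OF Infty] in auto)
  qed
  have critW: "critical_point R (Fin a) \<longleftrightarrow> poly (wronskian p q) a = 0" for a
    unfolding R_def by (rule critical_point_Fin_iff[OF nc])
  have qA: "poly q a \<noteq> 0" if "a \<in> A" for a
    using that nc by (auto simp: A_def polyF no_common_root_def)
  have mult: "multiplier R (Fin a) = poly (wronskian p q) a / (poly q a)\<^sup>2" if "a \<in> A" for a
    unfolding multiplier_def R_def
    by (rule has_local_deriv_imp_local_deriv[OF rational_fun_has_local_deriv_Fin[OF qA[OF that]]])
  have repelling: "norm (multiplier R (Fin a)) > 1" if a: "a \<in> A" "\<not> critical_point R (Fin a)" for a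
    unfolding mult[OF a(1)]
  proof (rule finite_fixed_points_repelling[OF nc])
    show "poly p c = c * poly q c" if "poly (wronskian p q) c = 0" for c
      using crit_fixed[of "Fin c"] critW[of c] that fixA[of c] by (simp add: A_def polyF)
  qed (use a degp degq \<open>n \<ge> 2\<close> critW in \<open>auto simp: A_def polyF\<close>)
  show "norm (multiplier R z) > 1" if "fixed_point R z" "\<not> critical_point R z" for z
    using that fixA repelling Infty by (cases z) auto
  have mult_ne_1: "multiplier R (Fin a) \<noteq> 1" if "a \<in> A" for a
    using repelling[OF that] by (force simp: critical_point_def multiplier_def)
  have deriv_F: "poly (pderiv F) a = - (1 - multiplier R (Fin a)) * poly q a" if "a \<in> A" for a
  proof -
    have "poly (wronskian p q) a = (poly q a)\<^sup>2 + poly (pderiv F) a * poly q a"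
      using that by (simp add: wronskian_eq_fixed_point_poly[of p q] A_def flip: F_def)
    then show ?thesis using qA[OF that] by (simp add: mult[OF that] field_simps power2_eq_square)
  qed
  have simple: "poly (pderiv F) a \<noteq> 0" if "poly F a = 0" for a
    using deriv_F[of a] mult_ne_1[of a] qA[of a] that by (simp add: A_def)
  have "F \<noteq> 0" using degF \<open>n \<ge> 2\<close> by auto
  then have A: "finite A" "card A = n"
    using card_roots_rsquarefree[OF _ simple] poly_roots_finite degF by (auto simp: A_def)
  show "card {z. fixed_point R z} = n + 1"
    using A by (simp add: fixed card_image inj_on_def card_insert_if image_iff)
  have "1 / (1 - multiplier R (Fin a)) = - (poly q a / poly (pderiv F) a)" if "a \<in> A" for a
    unfolding deriv_F[OF that] using mult_ne_1[OF that] qA[OF that] by (simp add: divide_simps)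
  then have "(\<Sum>a\<in>A. 1 / (1 - multiplier R (Fin a))) = - (\<Sum>a\<in>A. poly q a / poly (pderiv F) a)"
    by (simp add: sum_negf)
  also have "\<dots> = 0"
    using sum_over_simple_roots_eq_0[of F q] simple degF degq \<open>n \<ge> 2\<close> by (simp add: A_def)
  finally have "(\<Sum>z\<in>Fin ` A. 1 / (1 - multiplier R z)) = 0"
    by (simp add: sum.reindex inj_on_def)
  moreover have "multiplier R Infty = 0" using Infty by (simp add: critical_point_def multiplier_def)
  ultimately show "(\<Sum>z | fixed_point R z. 1 / (1 - multiplier R z)) = 1"
    using A(1) by (simp add: fixed sum.insert image_iff)
qed

section \<open>Moving a fixed point to infinity\<close>

lemma coeff_pcompose_translate:
  fixes r :: "'a :: idom poly"
  assumes "degree r \<le> n"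
  shows "coeff (pcompose r [:c, 1:]) n = coeff r n"
proof (cases "degree r = n")
  case True
  then show ?thesis using lead_coeff_comp[of "[:c, 1:]" r] by (simp add: degree_pcompose)
next
  case False
  then show ?thesis using assms by (simp add: coeff_eq_0 degree_pcompose)
qed

text \<open>
  Conjugation by \<open>1 / (z - c)\<close>. The conjugate has explicit numerator and denominator, namely the
  reversals of \<open>q\<close> and \<open>p - c q\<close> translated by \<open>c\<close>. The chain rule on the sphere shows that critical
  points and multipliers are carried along.
\<close>

lemma conjugate_fixed_point_to_Infty:
  fixes p q :: "complex poly"
  defines "R \<equiv> rational_fun p q"
  assumes nc: "no_common_root p q" and deg: "max (degree p) (degree q) = n" and "n > 0"
    and c: "fixed_point R (Fin c)"
  obtains p' q' \<psi> where "no_common_root p' q'" "max (degree p') (degree q') = n" "bij \<psi>" "\<psi> Infty = Fin c"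
    "\<And>b. fixed_point (rational_fun p' q') b \<longleftrightarrow> fixed_point R (\<psi> b)"
    "\<And>b. critical_point (rational_fun p' q') b \<longleftrightarrow> critical_point R (\<psi> b)"
    "\<And>b. fixed_point R (\<psi> b) \<Longrightarrow> multiplier (rational_fun p' q') b = multiplier R (\<psi> b)"
proof -
  define \<phi> where "\<phi> = rational_fun [:1:] [:-c, 1:]"
  define \<psi> where "\<psi> = rational_fun [:1, c:] [:0, 1:]"
  have \<phi>: "\<phi> Infty = Fin 0" "\<phi> (Fin z) = (if z = c then Infty else Fin (1 / (z - c)))" for z
    by (auto simp: \<phi>_def)
  have \<psi>: "\<psi> Infty = Fin c" "\<psi> (Fin w) = (if w = 0 then Infty else Fin (c + 1 / w))" for w
    by (auto simp: \<psi>_def field_simps)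
  have \<phi>\<psi>: "\<phi> (\<psi> b) = b" for b by (cases b) (auto simp: \<phi> \<psi>)
  have \<psi>\<phi>: "\<psi> (\<phi> a) = a" for a by (cases a) (auto simp: \<phi> \<psi>)
  have "bij \<psi>" using \<phi>\<psi> \<psi>\<phi> by (intro o_bij[of \<phi>]) (auto simp: fun_eq_iff)
  have d\<phi>: "has_local_deriv \<phi> a (local_deriv \<phi> a)" for a
    unfolding \<phi>_def by (rule rational_fun_has_local_deriv) (auto simp: no_common_root_def)
  have d\<psi>: "has_local_deriv \<psi> a (local_deriv \<psi> a)" for a
    unfolding \<psi>_def by (rule rational_fun_has_local_deriv) (auto simp: no_common_root_def)
  have dR: "has_local_deriv R a (local_deriv R a)" for a
    unfolding R_def by (rule rational_fun_has_local_deriv[OF nc]) (use deg \<open>n > 0\<close> in auto)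
  have inv1: "local_deriv \<phi> (\<psi> b) * local_deriv \<psi> b = 1" for b
  proof -
    have "\<phi> \<circ> \<psi> = (\<lambda>x. x)" using \<phi>\<psi> by auto
    then show ?thesis
      using has_local_deriv_compose[OF d\<psi>[of b] d\<phi>] has_local_deriv_id[of b] has_local_deriv_imp_local_deriv
      by metis
  qed
  define p1 q1 where "p1 = pcompose q [:c, 1:]" and "q1 = pcompose (p - smult c q) [:c, 1:]"
  define p' q' where "p' = reversal n p1" and "q' = reversal n q1"
  have degs: "degree p \<le> n" "degree q \<le> n" using deg by auto
  have deg1: "degree p1 \<le> n" "degree q1 \<le> n"
    using degs degree_diff_le[of p n "smult c q"] degree_smult_le[of c q]
    by (auto simp: p1_def q1_def degree_pcompose)
  have poly1: "poly p1 u = poly q (c + u)" "poly q1 u = poly p (c + u) - c * poly q (c + u)" for u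
    by (auto simp: p1_def q1_def poly_pcompose)
  have qc: "poly q c \<noteq> 0" "poly p c = c * poly q c"
    using c nc by (auto simp: R_def fixed_point_Fin_iff[OF nc] no_common_root_def)
  have coeff_top: "coeff p1 n = coeff q n" "coeff q1 n = coeff p n - c * coeff q n"
    using degs degree_diff_le[of p n "smult c q"] degree_smult_le[of c q]
    by (simp_all add: p1_def q1_def coeff_pcompose_translate)
  have degp': "degree p' = n" and degq': "degree q' \<le> n" and q'n: "coeff q' n = 0"
  proof -
    have c0: "coeff p1 0 = poly q c" "coeff q1 0 = 0"
      using poly1[of 0] qc by (simp_all add: poly_0_coeff_0)
    have "coeff p' n \<noteq> 0" using c0 deg1 qc by (simp add: p'_def coeff_reversal)
    then show "degree p' = n" using deg1
      by (intro antisym le_degree degree_le) (auto simp: p'_def coeff_reversal)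
    show "degree q' \<le> n" using deg1 by (intro degree_le) (auto simp: q'_def coeff_reversal)
    show "coeff q' n = 0" using c0 deg1 by (simp add: q'_def coeff_reversal)
  qed
  have top: "coeff q n \<noteq> 0 \<or> coeff p n \<noteq> 0"
    using deg \<open>n > 0\<close> by (metis degree_0 leading_coeff_0_iff max_def not_gr_zero)
  have nc': "no_common_root p' q'"
    unfolding no_common_root_def
  proof
    fix w show "poly p' w \<noteq> 0 \<or> poly q' w \<noteq> 0"
    proof (cases "w = 0")
      case True
      then show ?thesis using top deg1 coeff_top by (auto simp: p'_def q'_def poly_reversal)
    next
      case False
      then show ?thesis using nc deg1 by (auto simp: p'_def q'_def poly_reversal poly1 no_common_root_def)
    qed
  qed
  have deg': "max (degree p') (degree q') = n" using degp' degq' by simp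
  have conj: "rational_fun p' q' = (\<phi> \<circ> R) \<circ> \<psi>"
  proof
    fix b show "rational_fun p' q' b = ((\<phi> \<circ> R) \<circ> \<psi>) b"
    proof (cases b)
      case Infty
      then show ?thesis using c q'n deg' by (simp add: fixed_point_def \<phi> \<psi>)
    next
      case (Fin w)
      show ?thesis
      proof (cases "w = 0")
        case True
        then show ?thesis
          using Fin deg1 coeff_top deg top
          by (auto simp: \<psi> \<phi> R_def p'_def q'_def poly_reversal Let_def field_simps)
      next
        case False
        have p'w: "poly p' w = w ^ n * poly q (c + 1 / w)"
          "poly q' w = w ^ n * (poly p (c + 1 / w) - c * poly q (c + 1 / w))"
          using False deg1 by (simp_all add: p'_def q'_def poly_reversal poly1)
        have "poly p (c + 1 / w) \<noteq> 0 \<or> poly q (c + 1 / w) \<noteq> 0"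
          using nc by (simp add: no_common_root_def)
        then show ?thesis
          using Fin False by (auto simp: \<psi> \<phi> R_def p'w field_simps)
      qed
    qed
  qed
  have ld: "local_deriv (rational_fun p' q') b =
      local_deriv \<phi> (R (\<psi> b)) * local_deriv R (\<psi> b) * local_deriv \<psi> b" for b
    unfolding conj
    by (intro has_local_deriv_imp_local_deriv has_local_deriv_compose d\<phi> d\<psi> dR)
  have "local_deriv \<psi> b \<noteq> 0" for b using inv1[of b] by auto
  moreover have "local_deriv \<phi> a \<noteq> 0" for a using inv1[of "\<phi> a"] by (auto simp: \<psi>\<phi>)
  ultimately have critical: "critical_point (rational_fun p' q') b \<longleftrightarrow> critical_point R (\<psi> b)" for b
    by (simp add: critical_point_def ld)
  have fixed: "fixed_point (rational_fun p' q') b \<longleftrightarrow> fixed_point R (\<psi> b)" for b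
    by (simp add: fixed_point_def conj) (metis \<phi>\<psi> \<psi>\<phi>)
  have "multiplier (rational_fun p' q') b = multiplier R (\<psi> b)" if "fixed_point R (\<psi> b)" for b
    using that inv1[of b] by (simp add: multiplier_def ld fixed_point_def mult_ac)
  then show thesis using that[OF nc' deg' \<open>bij \<psi>\<close> \<psi>(1) fixed critical] by blast
qed

lemma no_common_root_if_coprime:
  fixes p q :: "complex poly"
  assumes "coprime p q"
  shows "no_common_root p q"
  unfolding no_common_root_def
proof (rule allI, rule ccontr)
  fix z assume "\<not> (poly p z \<noteq> 0 \<or> poly q z \<noteq> 0)"
  then have "[:-z, 1:] dvd p" "[:-z, 1:] dvd q" by (simp_all add: poly_eq_0_iff_dvd)
  then have "is_unit [:-z, 1:]" using assms by (rule coprime_common_divisor[rotated])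
  then show False by (simp add: is_unit_iff_degree)
qed

text \<open>
  If infinity is fixed, the Wronskian has positive degree and thus a root. Otherwise there is a finite
  fixed point, which a conjugation moves to infinity.
\<close>

lemma exists_critical_point:
  fixes p q :: "complex poly"
  assumes nc: "no_common_root p q" and deg: "max (degree p) (degree q) = n" and "n \<ge> 2"
  shows "\<exists>z. critical_point (rational_fun p q) z"
proof -
  have Infty_case: "\<exists>z. critical_point (rational_fun p q) z"
    if nc: "no_common_root p q" and deg: "max (degree p) (degree q) = n"
      and "rational_fun p q Infty = Infty" for p q
  proof -
    have "coeff q n = 0" using that by (auto simp: Let_def split: if_splits)
    then have "degree q \<noteq> n" using \<open>n \<ge> 2\<close> by auto
    then have "degree q < degree p" "degree p \<ge> 2" using deg \<open>n \<ge> 2\<close> by auto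
    then show ?thesis using wronskian_has_root[OF nc] critical_point_Fin_iff[OF nc] by blast
  qed
  show ?thesis
  proof (cases "rational_fun p q Infty = Infty")
    case True
    then show ?thesis using Infty_case nc deg by blast
  next
    case False
    then have "coeff q n \<noteq> 0" using deg by auto
    define F where "F = fixed_point_poly p q"
    have "coeff p (Suc n) = 0" using deg by (intro coeff_eq_0) auto
    then have "coeff F (Suc n) \<noteq> 0" using \<open>coeff q n \<noteq> 0\<close> by (simp add: F_def fixed_point_poly_def)
    then have "degree F > 0" using le_degree by fastforce
    then have "\<not> constant (poly F)" by (simp add: constant_degree)
    then obtain c where "poly F c = 0" using fundamental_theorem_of_algebra by blast
    then have "fixed_point (rational_fun p q) (Fin c)"
      using fixed_point_Fin_iff[OF nc] by (simp add: F_def fixed_point_poly_def)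
    moreover have "n > 0" using \<open>n \<ge> 2\<close> by simp
    ultimately obtain p' q' \<psi> where
      conj: "no_common_root p' q'" "max (degree p') (degree q') = n" "\<psi> Infty = Fin c"
        "\<And>b. fixed_point (rational_fun p' q') b \<longleftrightarrow> fixed_point (rational_fun p q) (\<psi> b)"
        "\<And>b. critical_point (rational_fun p' q') b \<longleftrightarrow> critical_point (rational_fun p q) (\<psi> b)"
      using conjugate_fixed_point_to_Infty[OF nc deg] by metis
    have "rational_fun p' q' Infty = Infty"
      using conj(3) conj(4)[of Infty] \<open>fixed_point (rational_fun p q) (Fin c)\<close>
      by (simp add: fixed_point_def)
    then show ?thesis using Infty_case[OF conj(1,2)] conj(5) by blast
  qed
qed

lemma fixed_points_of_critically_fixed:
  fixes p q :: "complex poly"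
  defines "R \<equiv> rational_fun p q"
  assumes nc: "no_common_root p q" and deg: "max (degree p) (degree q) = n" and "n \<ge> 2"
    and crit_fixed: "\<And>z. critical_point R z \<Longrightarrow> fixed_point R z"
  shows "card {z. fixed_point R z} = n + 1"
    and "\<And>z. fixed_point R z \<Longrightarrow> \<not> critical_point R z \<Longrightarrow> norm (multiplier R z) > 1"
    and "(\<Sum>z | fixed_point R z. 1 / (1 - multiplier R z)) = 1"
proof -
  obtain z0 where z0: "critical_point R z0"
    using exists_critical_point[OF nc deg \<open>n \<ge> 2\<close>] by (auto simp: R_def)
  obtain p' q' \<psi> where
    conj: "no_common_root p' q'" "max (degree p') (degree q') = n" "bij \<psi>" "\<psi> Infty = z0"
      "\<And>b. fixed_point (rational_fun p' q') b \<longleftrightarrow> fixed_point R (\<psi> b)"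
      "\<And>b. critical_point (rational_fun p' q') b \<longleftrightarrow> critical_point R (\<psi> b)"
      "\<And>b. fixed_point R (\<psi> b) \<Longrightarrow> multiplier (rational_fun p' q') b = multiplier R (\<psi> b)"
  proof (cases z0)
    case Infty
    then show thesis using that[of p q "\<lambda>x. x"] nc deg by (simp add: R_def bij_id[unfolded id_def])
  next
    case (Fin c)
    have "n > 0" using \<open>n \<ge> 2\<close> by simp
    moreover have "fixed_point R (Fin c)" using crit_fixed[OF z0] Fin by simp
    ultimately show thesis
      using conjugate_fixed_point_to_Infty[OF nc deg, folded R_def, of c thesis] that Fin by blast
  qed
  define R' where "R' = rational_fun p' q'"
  note conj' = conj(5-7)[folded R'_def]
  have Infty: "critical_point R' Infty" using conj'(2)[of Infty] conj(4) z0 by simp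
  have crit_fixed': "fixed_point R' z" if "critical_point R' z" for z
    using that conj'(1,2) crit_fixed by blast
  note normal = normal_form_fixed_points[OF conj(1,2) \<open>n \<ge> 2\<close>, folded R'_def, OF crit_fixed' Infty]
  have inj: "inj_on \<psi> A" for A using conj(3) by (meson bij_is_inj inj_on_subset subset_UNIV)
  have surj: "\<exists>b. z = \<psi> b" for z using conj(3) by (metis bij_pointE)
  have image: "{z. fixed_point R z} = \<psi> ` {b. fixed_point R' b}"
  proof
    show "{z. fixed_point R z} \<subseteq> \<psi> ` {b. fixed_point R' b}"
      using surj conj'(1) by (metis (mono_tags, lifting) image_eqI mem_Collect_eq subsetI)
  qed (use conj'(1) in auto)
  show "card {z. fixed_point R z} = n + 1"
    unfolding image card_image[OF inj] by (rule normal(1))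
  show "norm (multiplier R z) > 1" if z: "fixed_point R z" "\<not> critical_point R z" for z
  proof -
    obtain b where b: "z = \<psi> b" using surj by blast
    show ?thesis using normal(2)[of b] conj'[of b] z unfolding b by simp
  qed
  have "(\<Sum>z | fixed_point R z. 1 / (1 - multiplier R z)) =
      (\<Sum>b | fixed_point R' b. 1 / (1 - multiplier R' b))"
    unfolding image sum.reindex[OF inj] o_def using conj' by (intro sum.cong) auto
  then show "(\<Sum>z | fixed_point R z. 1 / (1 - multiplier R z)) = 1" using normal(3) by simp
qed

section \<open>Multipliers and the disc\<close>

text \<open>
  The map \<open>\<mu> \<mapsto> 1 / (1 - \<mu>)\<close> sends the exterior of the unit circle into the half plane to the left of
  \<open>1 / 2\<close>.
\<close>

lemma Re_inverse_lt_half: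
  fixes \<mu> :: complex
  assumes "norm \<mu> > 1"
  shows "Re (1 / (1 - \<mu>)) < 1 / 2"
proof -
  define x y where "x = Re \<mu>" and "y = Im \<mu>"
  have "1 < (norm \<mu>)\<^sup>2" using assms by (simp add: power2_eq_square less_1_mult)
  then have n: "1 < x\<^sup>2 + y\<^sup>2" by (simp add: cmod_power2 x_def y_def)
  have "1 - \<mu> \<noteq> 0" using assms by auto
  then have pos: "(1 - x)\<^sup>2 + y\<^sup>2 > 0"
    by (metis complex_neq_0 x_def y_def minus_complex.simps diff_0 one_complex.simps power2_minus)
  have "Re (1 / (1 - \<mu>)) = (1 - x) / ((1 - x)\<^sup>2 + y\<^sup>2)"
    by (simp add: Re_divide x_def y_def)
  also have "\<dots> < 1 / 2"
    using pos n by (simp add: field_simps power2_eq_square)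
  finally show ?thesis .
qed

text \<open>
  The same map sends the disc whose diameter is the interval from \<open>1\<close> to \<open>1 + 2 / k\<close>, without the point
  \<open>1\<close>, onto a half plane bounded by a vertical line.
\<close>

lemma Re_inverse_le_if_in_disc:
  fixes \<mu> :: complex and k :: real
  assumes "k > 0" and "\<mu> \<noteq> 1" and "\<mu> \<in> disc_with_diameter 1 (of_real (1 + 2 / k))"
  shows "Re (1 / (1 - \<mu>)) \<le> - k / 2"
proof -
  define x y where "x = Re \<mu> - 1" and "y = Im \<mu>"
  have mid: "midpoint 1 (of_real (1 + 2 / k)) = (of_real (1 + 1 / k) :: complex)"
    by (simp add: midpoint_def complex_eq_iff scaleR_conv_of_real field_simps)
  have "dist 1 (of_real (1 + 2 / k) :: complex) = 2 / k"
  proof -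
    have "(1 :: complex) - of_real (1 + 2 / k) = of_real (- (2 / k))" by simp
    then show ?thesis using \<open>k > 0\<close> by (simp only: dist_norm norm_of_real) simp
  qed
  then have "norm (\<mu> - of_real (1 + 1 / k)) \<le> 1 / k"
    using assms(3) by (simp add: disc_with_diameter_def mid dist_norm norm_minus_commute del: of_real_add)
  then have "(norm (\<mu> - of_real (1 + 1 / k)))\<^sup>2 \<le> (1 / k)\<^sup>2" by (intro power_mono) auto
  then have "(x - 1 / k)\<^sup>2 + y\<^sup>2 \<le> (1 / k)\<^sup>2" by (simp add: cmod_power2 x_def y_def algebra_simps)
  then have "x\<^sup>2 + y\<^sup>2 \<le> 2 * x / k" by (simp add: power2_eq_square algebra_simps)
  then have le: "k * (x\<^sup>2 + y\<^sup>2) \<le> 2 * x" using \<open>k > 0\<close> by (simp add: field_simps)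
  have pos: "x\<^sup>2 + y\<^sup>2 > 0"
    using \<open>\<mu> \<noteq> 1\<close> by (auto simp: x_def y_def complex_eq_iff sum_power2_gt_zero_iff)
  have "Re (1 / (1 - \<mu>)) = - x / (x\<^sup>2 + y\<^sup>2)"
    by (simp add: Re_divide x_def y_def power2_commute)
  also have "\<dots> \<le> - k / 2" using pos le by (simp add: field_simps)
  finally show ?thesis .
qed

theorem theorem3:
  fixes R :: "riemann_sphere \<Rightarrow> riemann_sphere" and n m :: nat
  defines "N \<equiv> {z. fixed_point R z \<and> \<not> critical_point R z}"
  assumes "n \<ge> 2"
    and "rational_map n R"
    and "\<And>z. critical_point R z \<Longrightarrow> fixed_point R z"
    and "m = card {z. critical_point R z}"
  shows "card {z. fixed_point R z} = n + 1 \<and>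
    int (card N) = int n + 1 - int m \<and>
    (\<forall>z\<in>N. multiplier R z \<in> disc_with_diameter 1 (of_real (1 + 2 / (real n + real m - 2)))
        \<longrightarrow> m = n \<and> multiplier R z = of_nat n / (of_nat n - 1)) \<and>
    (m = n \<longrightarrow> (\<exists>z. N = {z} \<and> multiplier R z = of_nat n / (of_nat n - 1) \<and>
        multiplier R z \<in> frontier (disc_with_diameter 1 (of_real (1 + 2 / (real n + real m - 2))))))"
proof -
  obtain p q where pq: "coprime p q" "max (degree p) (degree q) = n" "R = rational_fun p q"
    using \<open>rational_map n R\<close> by (auto simp: rational_map_def)
  note nc = no_common_root_if_coprime[OF pq(1)]
  note fixed = fixed_points_of_critically_fixed[OF nc pq(2) \<open>n \<ge> 2\<close>, folded pq(3), OF assms(4)]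
  define C where "C = {z. critical_point R z}"
  define X where "X = {z. fixed_point R z}"
  define \<mu> where "\<mu> = multiplier R"
  have "finite X" using fixed(1) card.infinite by (fastforce simp: X_def)
  have "C \<subseteq> X" using assms(4) by (auto simp: C_def X_def)
  have N: "N = X - C" by (auto simp: N_def X_def C_def)
  have "finite C" "finite N" using \<open>finite X\<close> \<open>C \<subseteq> X\<close> finite_subset N by auto
  have "m = card C" using assms(5) by (simp add: C_def)
  have "card X = n + 1" using fixed(1) by (simp add: X_def)
  then have cardN: "card N + m = n + 1"
    using card_Diff_subset[OF \<open>finite C\<close> \<open>C \<subseteq> X\<close>] card_mono[OF \<open>finite X\<close> \<open>C \<subseteq> X\<close>] \<open>m = card C\<close>
    by (simp add: N)
  have "C \<noteq> {}" using exists_critical_point[OF nc pq(2) \<open>n \<ge> 2\<close>] by (auto simp: C_def pq(3))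
  then have "m \<ge> 1" using \<open>finite C\<close> \<open>m = card C\<close> by (simp add: Suc_leI card_gt_0_iff)
  define k where "k = real n + real m - 2"
  have "k > 0" using \<open>n \<ge> 2\<close> \<open>m \<ge> 1\<close> by (simp add: k_def)
  have repelling: "norm (\<mu> z) > 1" if "z \<in> N" for z
    using fixed(2) that by (simp add: N_def \<mu>_def)
  have "(\<Sum>z\<in>X. 1 / (1 - \<mu> z)) = 1" using fixed(3) by (simp add: X_def \<mu>_def)
  moreover have "(\<Sum>z\<in>X. 1 / (1 - \<mu> z)) = (\<Sum>z\<in>N. 1 / (1 - \<mu> z)) + (\<Sum>z\<in>C. 1 / (1 - \<mu> z))"
    unfolding N by (rule sum.subset_diff[OF \<open>C \<subseteq> X\<close> \<open>finite X\<close>])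
  moreover have "(\<Sum>z\<in>C. 1 / (1 - \<mu> z)) = of_nat m"
    using \<open>m = card C\<close> by (simp add: C_def \<mu>_def multiplier_def critical_point_def)
  ultimately have index: "(\<Sum>z\<in>N. 1 / (1 - \<mu> z)) = 1 - of_nat m" by (simp add: algebra_simps)
  have unique: "\<mu> z = of_nat n / (of_nat n - 1)" if "m = n" "N = {z}" for z
  proof -
    have "1 / (1 - \<mu> z) = 1 - of_nat n" using index that by simp
    then have "1 - \<mu> z = 1 / (1 - of_nat n)" by (metis inverse_eq_divide inverse_inverse_eq)
    then have "\<mu> z = 1 - 1 / (1 - of_nat n)" by (simp add: algebra_simps)
    also have "(of_nat n :: complex) \<noteq> 1" using \<open>n \<ge> 2\<close> by simp
    then have "1 - 1 / (1 - of_nat n) = (of_nat n / (of_nat n - 1) :: complex)"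
      by (simp add: divide_simps) (simp add: algebra_simps)
    finally show ?thesis .
  qed
  have in_disc: "m = n \<and> \<mu> z = of_nat n / (of_nat n - 1)"
    if z: "z \<in> N" "\<mu> z \<in> disc_with_diameter 1 (of_real (1 + 2 / k))" for z
  proof -
    have "\<mu> z \<noteq> 1" using repelling[OF z(1)] by auto
    from Re_inverse_le_if_in_disc[OF \<open>k > 0\<close> this z(2)]
    have le: "Re (1 / (1 - \<mu> z)) \<le> - k / 2" .
    have "(\<Sum>w\<in>N. Re (1 / (1 - \<mu> w))) = 1 - real m" using arg_cong[OF index, of Re] by simp
    then have others: "(\<Sum>w\<in>N - {z}. Re (1 / (1 - \<mu> w))) = 1 - real m - Re (1 / (1 - \<mu> z))"
      using sum.remove[OF \<open>finite N\<close> z(1), of "\<lambda>w. Re (1 / (1 - \<mu> w))"] by simp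
    have rest: "card (N - {z}) + m = n" using card_Suc_Diff1[OF \<open>finite N\<close> z(1)] cardN by simp
    then have cardr: "real (card (N - {z})) = real n - real m" by (simp flip: of_nat_add)
    \<comment> \<open>The other \<open>n - m\<close> repelling points contribute less than \<open>(n - m) / 2\<close> to the real part of the
        index sum, which is too little to compensate for \<open>z\<close>, unless there are none.\<close>
    have "N - {z} = {}"
    proof (rule ccontr)
      assume "N - {z} \<noteq> {}"
      then have "(\<Sum>w\<in>N - {z}. Re (1 / (1 - \<mu> w))) < (\<Sum>w\<in>N - {z}. 1 / 2)"
        using \<open>finite N\<close> Re_inverse_lt_half repelling by (intro sum_strict_mono) auto
      then show False using others le cardr by (simp add: k_def field_simps)
    qed
    have "m = n" using rest unfolding \<open>N - {z} = {}\<close> by simp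
    moreover have "N = {z}" using z(1) \<open>N - {z} = {}\<close> by blast
    ultimately show ?thesis using unique by blast
  qed
  have on_frontier: "\<mu> z \<in> frontier (disc_with_diameter 1 (of_real (1 + 2 / k)))"
    if "m = n" "N = {z}" for z
  proof -
    have "of_nat n / (of_nat n - 1) = (of_real (1 + 2 / k) :: complex)"
      using \<open>n \<ge> 2\<close> that(1) by (simp add: k_def field_simps)
    then have \<mu>: "\<mu> z = of_real (1 + 2 / k)" using unique[OF that] by simp
    have "midpoint 1 b = midpoint b 1" "dist (midpoint b 1) b = dist 1 b / 2" for b :: complex
      by (simp_all add: midpoint_sym dist_midpoint dist_commute)
    then show ?thesis unfolding \<mu> disc_with_diameter_def frontier_cball by simp
  qed
  have "\<exists>z. N = {z}" if "m = n" using cardN that by (simp add: card_1_singleton_iff)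
  then have "m = n \<longrightarrow> (\<exists>z. N = {z} \<and> \<mu> z = of_nat n / (of_nat n - 1) \<and>
      \<mu> z \<in> frontier (disc_with_diameter 1 (of_real (1 + 2 / k))))"
    using unique on_frontier by blast
  then show ?thesis
    using \<open>card X = n + 1\<close> cardN in_disc unfolding X_def \<mu>_def k_def by auto
qed

end
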